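(* Let $\mathcal{G}=(\mathcal{V},\mathcal{E})$ be a simple connected graph of order $n$, let $1\le r<n$, and let $\mathcal{E}_{cs}\subseteq\mathcal{E}$ be a set of edges with $|\mathcal{E}_{cs}|=n-r$. If the contraction $\mathcal{G}/\!/\mathcal{E}_{cs}$ is cycle-invariant, then $\mathcal{L}(\mathcal{G}/\!/\mathcal{E}_{cs})$ interlaces $\mathcal{L}(\mathcal{G})$, where $\mathcal{L}$ denotes the normalized Laplacian matrix.
   Context: Graphs are undirected. The normalized Laplacian $\mathcal{L}(\mathcal{G})$ has $[\mathcal{L}(\mathcal{G})]_{uu}=1$, $[\mathcal{L}(\mathcal{G})]_{uv}=-\left(\sqrt{d_u(\mathcal{G})d_v(\mathcal{G})}\right)^{-1}$ if $u\sim v$, and $0$ otherwise, where $d_u(\mathcal{G})$ is the degree of $u$ and $u\sim v$ means that $u$ and $v$ are adjacent. Contraction: for a partition $\pi$ of $\mathcal{V}$ into cells $C_1(\pi),\dots,C_p(\pi)$, the contraction $\mathcal{G}/\!/\pi$ is the simple graph with vertex set $\{1,\dots,p\}$ in which $i\ne j$ are adjacent iff some edge of $\mathcal{G}$ joins a vertex of $C_i(\pi)$ to a vertex of $C_j(\pi)$. For $\mathcal{E}_{cs}\subseteq\mathcal{E}$, let $\pi_c(\mathcal{G},\mathcal{E}_{cs})$ be the partition of $\mathcal{V}$ into the vertex sets of the connected components of the graph $(\mathcal{V},\mathcal{E}_{cs})$, and $\mathcal{G}/\!/\mathcal{E}_{cs}:=\mathcal{G}/\!/\pi_c(\mathcal{G},\mathcal{E}_{cs})$.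 Cycle-invariance: a contraction $\mathcal{G}/\!/\pi$ is cycle-invariant if there is a one-to-one mapping between the set of simple cycles of $\mathcal{G}$ and the set of simple cycles of $\mathcal{G}/\!/\pi$. (A simple cycle is a path, i.e. a sequence of distinct adjacent nodes, with an additional edge such that the first and last vertices are repeated.) Interlacing: a real symmetric matrix $B\in\mathbb{R}^{p\times p}$ interlaces a real symmetric matrix $A\in\mathbb{R}^{n\times n}$, $0<p<n$, if $\lambda_k(A)\le\lambda_k(B)\le\lambda_{n-p+k}(A)$ for $k=1,\dots,p$, where $\lambda_k$ is the $k$th eigenvalue in ascending order. *)

theory Defs
  imports
    "Jordan_Normal_Form.Char_Poly"
    "HOL-Library.Multiset"
begin

record 'a graph =
  verts :: "'a set"
  edges :: "'a set set"

definition simple_graph :: "'a graph \<Rightarrow> bool" where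
  "simple_graph G \<longleftrightarrow>
     finite (verts G) \<and> (\<forall>e\<in>edges G. \<exists>u\<in>verts G. \<exists>v\<in>verts G. u \<noteq> v \<and> e = {u, v})"

definition adj :: "'a graph \<Rightarrow> 'a \<Rightarrow> 'a \<Rightarrow> bool" where
  "adj G u v \<longleftrightarrow> {u, v} \<in> edges G"

definition degree_of :: "'a graph \<Rightarrow> 'a \<Rightarrow> nat" where
  "degree_of G u = card {v \<in> verts G. adj G u v}"

definition connectivity :: "'a graph \<Rightarrow> ('a \<times> 'a) set" where
  "connectivity G = {(u, v). u \<in> verts G \<and> v \<in> verts G \<and> (adj G)\<^sup>*\<^sup>* u v}"

definition connected_graph :: "'a graph \<Rightarrow> bool" where
  "connected_graph G \<longleftrightarrow> connectivity G = verts G \<times> verts G"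

definition components :: "'a graph \<Rightarrow> 'a set set" where
  "components G = verts G // connectivity G"

definition contraction_partition :: "'a graph \<Rightarrow> 'a set set \<Rightarrow> 'a set set" where
  "contraction_partition G Ecs = components \<lparr>verts = verts G, edges = Ecs\<rparr>"

text \<open>A partition into cells is given as a list, so that the contraction has the indices of
  the cells as vertices; indices start at 0.\<close>

definition contraction :: "'a graph \<Rightarrow> 'a set list \<Rightarrow> nat graph" where
  "contraction G cells =
     \<lparr>verts = {..<length cells},
      edges = {{i, j} | i j. i < length cells \<and> j < length cells \<and> i \<noteq> j \<and>
                 (\<exists>u \<in> cells ! i. \<exists>v \<in> cells ! j. adj G u v)}\<rparr>"

definition path_in :: "'a graph \<Rightarrow> 'a list \<Rightarrow> bool" where
  "path_in G xs \<longleftrightarrow>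
     xs \<noteq> [] \<and> set xs \<subseteq> verts G \<and> distinct xs \<and> successively (adj G) xs"

text \<open>A simple cycle is a vertex sequence \<open>v\<^sub>1, \<dots>, v\<^sub>k, v\<^sub>1\<close>; sequences that differ in the starting
  point or in the direction of traversal are different simple cycles. The identification of
  such sequences is not an option: contracting an edge of the 4-cycle gives the triangle, whose
  normalized Laplacian (eigenvalues 0, 3/2, 3/2) does not interlace that of the 4-cycle
  (eigenvalues 0, 1, 1, 2). The condition \<open>3 \<le> length xs\<close> says that the
  closing edge is not already an edge of the path.\<close>

definition simple_cycles :: "'a graph \<Rightarrow> 'a list set" where
  "simple_cycles G =
     {xs @ [hd xs] | xs. path_in G xs \<and> 3 \<le> length xs \<and> adj G (last xs) (hd xs)}"

definition cycle_invariant :: "'a graph \<Rightarrow> 'a set list \<Rightarrow> bool" where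
  "cycle_invariant G cells \<longleftrightarrow>
     (\<exists>f. bij_betw f (simple_cycles G) (simple_cycles (contraction G cells)))"

text \<open>The rows and columns are indexed by the vertices in the order of the list \<open>vs\<close>, which is
  meant to enumerate the vertices without repetition.\<close>

definition norm_laplacian :: "'a graph \<Rightarrow> 'a list \<Rightarrow> real mat" where
  "norm_laplacian G vs = mat (length vs) (length vs) (\<lambda>(i, j).
     let u = vs ! i; v = vs ! j in
     if u = v then 1
     else if adj G u v then - inverse (sqrt (real (degree_of G u) * real (degree_of G v)))
     else 0)"

text \<open>The \<open>k\<close>th eigenvalue in ascending order, counted with multiplicity, for \<open>k = 1, \<dots>, n\<close>.
  Only used for symmetric real matrices, whose characteristic polynomial has \<open>n\<close> real roots.\<close>

definition nth_eigenvalue :: "nat \<Rightarrow> real mat \<Rightarrow> real" where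
  "nth_eigenvalue k A = sorted_list_of_multiset (proots (char_poly A)) ! (k - 1)"

definition real_symmetric :: "nat \<Rightarrow> real mat \<Rightarrow> bool" where
  "real_symmetric n A \<longleftrightarrow> A \<in> carrier_mat n n \<and> transpose_mat A = A"

definition interlaces :: "real mat \<Rightarrow> real mat \<Rightarrow> bool" where
  "interlaces B A \<longleftrightarrow>
     (\<exists>p n. 0 < p \<and> p < n \<and> real_symmetric p B \<and> real_symmetric n A \<and>
       (\<forall>k\<in>{1..p}. nth_eigenvalue k A \<le> nth_eigenvalue k B \<and>
                    nth_eigenvalue k B \<le> nth_eigenvalue (n - p + k) A))"

end

theory Submission
  imports Defs "HOL-Combinatorics.List_Permutation"
begin

text \<open>
  The theorem has a combinatorial half, which extracts from cycle-invariance that every contracted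
  edge is a bridge, and an analytic half, which compares Rayleigh quotients across a contraction
  of bridges.

  Combinatorics. Every simple cycle \<open>c\<close> of the quotient lifts to a simple cycle of \<open>G\<close>: take an edge
  of \<open>G\<close> over each edge of \<open>c\<close> and join consecutive endpoints inside the cells. The closing edge of
  the lift runs between different cells, and \<open>c\<close> is recovered by projecting the lift and deleting
  repetitions. So the quotient has at most as many simple cycles as \<open>G\<close> has with a closing edge
  between different cells; as both cycle sets are finite and equinumerous, every cycle of \<open>G\<close>
  closes with such an edge (\<open>cycle_invariant_cycle_crosses_cells\<close>). A contracted edge on a cycle
  could be made its closing edge, so no contracted edge lies on a cycle: it is a bridge
  (\<open>cycle_invariant_contracted_bridge\<close>). Since bridges separate any two vertices of a common cell,
  edges of \<open>G\<close> between different cells correspond exactly to edges of the quotient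
  (\<open>sum_cross_edges\<close>), all edges inside cells are contracted, and there is a function
  \<open>switching\<close> with values \<open>1\<close> and \<open>-1\<close> that changes its sign precisely along the contracted edges.

  Analysis. With \<open>y u = sqrt (d u) * g u\<close> the quadratic form of the normalized Laplacian at \<open>y\<close> is the sum
  of \<open>(g u - g v)^2\<close> over the edges, and that of \<open>2 - L\<close> is the sum of \<open>(g u + g v)^2\<close>
  (\<open>norm_laplacian_quadratic_form\<close>). A function \<open>h\<close> on the quotient gives two functions on \<open>G\<close>: the
  pullback along \<open>cell\<close>, for which the edges inside cells contribute nothing to the first sum, and the
  pullback multiplied by \<open>switching\<close>, for which they contribute nothing to the second. All other
  edges contribute as in the quotient, while the norm can only grow. By the argument of Courant
  and Fischer (\<open>nth_eigenvalue_le_of_form_pullback\<close>), the first pullback bounds the eigenvalues of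
  the quotient from below; the second one does the same for \<open>2 - L\<close>, which reverses the order
  of the eigenvalues and thus gives the bound from above.
\<close>

section \<open>The spectral theorem for real symmetric matrices\<close>

text \<open>Over the complex numbers the characteristic polynomial has a root; symmetry moves the matrix
  across the Hermitian product, so that the root equals its conjugate.\<close>

lemma real_symmetric_eigenvalue_exists:
  fixes A :: "real mat"
  assumes A: "A \<in> carrier_mat n n" and sym: "transpose_mat A = A" and n: "0 < n"
  shows "\<exists>e. eigenvalue A e"
proof -
  define C where "C = map_mat complex_of_real A"
  have C: "C \<in> carrier_mat n n" using A by (simp add: C_def)
  have symC: "transpose_mat C = C" unfolding C_def map_mat_transpose sym ..
  obtain as where cp: "char_poly C = (\<Prod>a\<leftarrow>as. [:- a, 1:])" and len: "length as = n"
    using char_poly_factorized[OF C] by blast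
  obtain a as' where as: "as = a # as'" using len n by (cases as) auto
  have root: "poly (char_poly C) a = 0" unfolding cp as by simp
  then have "eigenvalue C a" using eigenvalue_root_char_poly[OF C] by blast
  then obtain v where v: "v \<in> carrier_vec n" "v \<noteq> 0\<^sub>v n" and ev: "C *\<^sub>v v = a \<cdot>\<^sub>v v"
    unfolding eigenvalue_def eigenvector_def using C by auto
  have cv: "conjugate v \<in> carrier_vec n" using v by simp
  have conj: "C *\<^sub>v conjugate v = conjugate (C *\<^sub>v v)"
    using v A by (intro eq_vecI) (auto simp: C_def scalar_prod_def sum_conjugate conjugate_complex_def)
  have "a * (v \<bullet>c v) = (transpose_mat C *\<^sub>v v) \<bullet>c v"
    using v cv by (simp add: symC ev)
  also have "\<dots> = v \<bullet> (C *\<^sub>v conjugate v)"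
    by (rule transpose_vec_mult_scalar[OF C cv v(1)])
  also have "\<dots> = cnj a * (v \<bullet>c v)"
    using v cv by (simp add: conj ev conjugate_smult_vec conjugate_complex_def)
  finally have "a = cnj a" using v by simp
  then have a: "a = complex_of_real (Re a)" by (simp add: complex_eq_iff)
  have "poly (char_poly C) a = complex_of_real (poly (char_poly A) (Re a))"
    unfolding C_def of_real_hom.char_poly_hom[OF A] by (subst a) simp
  then have "poly (char_poly A) (Re a) = 0" using root by simp
  then show ?thesis using eigenvalue_root_char_poly[OF A] by blast
qed

text \<open>The reflection in the hyperplane orthogonal to \<open>v - e\<close>, with \<open>e\<close> the first unit vector, exchanges
  \<open>e\<close> and \<open>v\<close>. It serves as an orthogonal change of basis whose first basis vector is \<open>v\<close>.\<close>

lemma householder_reflection_exists: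
  fixes v :: "real vec"
  assumes v: "v \<in> carrier_vec (Suc n)" and unit: "v \<bullet> v = 1"
  shows "\<exists>H \<in> carrier_mat (Suc n) (Suc n).
    transpose_mat H = H \<and> H * H = 1\<^sub>m (Suc n) \<and> H *\<^sub>v unit_vec (Suc n) 0 = v"
proof (cases "v = unit_vec (Suc n) 0")
  case True
  then show ?thesis by (intro bexI[of _ "1\<^sub>m (Suc n)"]) auto
next
  case False
  let ?N = "Suc n"
  define w where "w = v - unit_vec ?N 0"
  have w: "w \<in> carrier_vec ?N" using v by (simp add: w_def)
  define s where "s = (\<Sum>k<?N. w $ k * w $ k)"
  have "w \<noteq> 0\<^sub>v ?N"
  proof
    assume "w = 0\<^sub>v ?N"
    then have "(v - unit_vec ?N 0) $ k = 0" if "k < ?N" for k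
      using that by (simp add: w_def)
    then have "v $ k = unit_vec ?N 0 $ k" if "k < ?N" for k
      using that v by fastforce
    then have "v = unit_vec ?N 0" using v by (intro eq_vecI) auto
    with False show False ..
  qed
  moreover have sw: "s = w \<bullet> w" using w by (simp add: s_def scalar_prod_def atLeast0LessThan)
  ultimately have s0: "s \<noteq> 0"
    using conjugate_square_eq_0_vec[OF w] by (auto simp: vec_conjugate_real)
  \<comment> \<open>As \<open>v\<close> is a unit vector, the squared length of \<open>w\<close> is fixed by its first entry.\<close>
  have "s = (\<Sum>k<?N. v $ k * v $ k - 2 * (if k = 0 then v $ 0 else 0) + (if k = 0 then 1 else 0))"
    unfolding s_def using v by (intro sum.cong) (auto simp: w_def algebra_simps)
  also have "\<dots> = v \<bullet> v - 2 * v $ 0 + 1"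
    using v by (simp add: sum.distrib sum_subtractf scalar_prod_def atLeast0LessThan
        flip: sum_distrib_left del: sum.lessThan_Suc)
  finally have s: "s = - 2 * w $ 0" using unit v by (simp add: w_def)
  define H where "H = mat ?N ?N (\<lambda>(i,j). (if i = j then 1 else 0) - 2 / s * w $ i * w $ j)"
  have H: "H \<in> carrier_mat ?N ?N" by (simp add: H_def)
  have "H * H = 1\<^sub>m ?N"
  proof (rule eq_matI)
    fix i j assume "i < dim_row (1\<^sub>m ?N)" "j < dim_col (1\<^sub>m ?N)"
    then have i: "i < ?N" and j: "j < ?N" by auto
    have "(H * H) $$ (i,j) = (\<Sum>k<?N. ((if i = k then 1 else 0) - 2 / s * w $ i * w $ k) *
        ((if k = j then 1 else 0) - 2 / s * w $ k * w $ j))"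
      using i j by (simp add: H_def scalar_prod_def atLeast0LessThan del: sum.lessThan_Suc)
    also have "\<dots> = (\<Sum>k<?N. (if k = i then (if i = j then 1 else 0) - 2 / s * w $ i * w $ j else 0)
        - (if k = j then 2 / s * w $ i * w $ j else 0)
        + (2 / s * w $ i * (2 / s * w $ j)) * (w $ k * w $ k))"
      by (intro sum.cong) (auto simp: algebra_simps)
    also have "\<dots> = (if i = j then 1 else 0) - 2 / s * w $ i * w $ j - 2 / s * w $ i * w $ j
        + (2 / s * w $ i * (2 / s * w $ j)) * s"
      using i j by (simp only: sum.distrib sum_subtractf s_def flip: sum_distrib_left) simp
    also have "\<dots> = 1\<^sub>m ?N $$ (i,j)" using s0 i j by simp
    finally show "(H * H) $$ (i,j) = 1\<^sub>m ?N $$ (i,j)" .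
  qed (auto simp: H_def)
  moreover have "transpose_mat H = H" by (rule eq_matI) (auto simp: H_def)
  moreover have "H *\<^sub>v unit_vec ?N 0 = v"
  proof (rule eq_vecI)
    fix i assume "i < dim_vec v"
    then have i: "i < ?N" using v by simp
    have "(H *\<^sub>v unit_vec ?N 0) $ i = H $$ (i, 0)"
      using i H by simp
    also have "\<dots> = (if i = 0 then 1 else 0) + w $ i"
      using i s0 s by (auto simp: H_def)
    also have "\<dots> = v $ i" using i v by (auto simp: w_def)
    finally show "(H *\<^sub>v unit_vec ?N 0) $ i = v $ i" .
  qed (use v H in auto)
  ultimately show ?thesis using H by blast
qed

text \<open>The diagonal is a function on indices, so that eigenvalues can be reordered and reflected by
  composing functions; both products of \<open>U\<close> with its transpose are recorded, because the proofs
  cancel on either side.\<close>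

definition orthogonally_diagonalizes :: "nat \<Rightarrow> real mat \<Rightarrow> (nat \<Rightarrow> real) \<Rightarrow> real mat \<Rightarrow> bool" where
  "orthogonally_diagonalizes n U \<alpha> A \<longleftrightarrow> U \<in> carrier_mat n n \<and>
     transpose_mat U * U = 1\<^sub>m n \<and> U * transpose_mat U = 1\<^sub>m n \<and>
     A = U * mat_diag n \<alpha> * transpose_mat U"

text \<open>By deflation: conjugating with the reflection that takes the first unit vector to a unit
  eigenvector turns \<open>A\<close> into a block matrix with the eigenvalue in the corner, zeros next to it, and a
  smaller symmetric block.\<close>

theorem real_symmetric_spectral:
  fixes A :: "real mat"
  assumes "A \<in> carrier_mat n n" and "transpose_mat A = A"
  shows "\<exists>U \<alpha>. orthogonally_diagonalizes n U \<alpha> A"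
  using assms
proof (induction n arbitrary: A)
  case 0
  then show ?case
    by (intro exI[of _ "1\<^sub>m 0"] exI[of _ "\<lambda>_. 0"]) (auto simp: orthogonally_diagonalizes_def)
next
  case (Suc n)
  let ?N = "Suc n"
  note A = Suc.prems(1) and sym = Suc.prems(2)
  obtain e w where w: "w \<in> carrier_vec ?N" "w \<noteq> 0\<^sub>v ?N" and ew: "A *\<^sub>v w = e \<cdot>\<^sub>v w"
    using real_symmetric_eigenvalue_exists[OF A sym] A
    unfolding eigenvalue_def eigenvector_def by auto
  define v where "v = (1 / sqrt (w \<bullet> w)) \<cdot>\<^sub>v w"
  have v: "v \<in> carrier_vec ?N" using w by (simp add: v_def)
  have "w \<bullet> w > 0" using conjugate_square_greater_0_vec[OF w(1)] w(2) by (simp add: vec_conjugate_real)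
  then have vv: "v \<bullet> v = 1" using w by (simp add: v_def field_simps)
  have ev: "A *\<^sub>v v = e \<cdot>\<^sub>v v"
    using A w by (simp add: v_def mult_mat_vec ew smult_smult_assoc mult.commute)
  obtain H where H: "H \<in> carrier_mat ?N ?N" and HT: "transpose_mat H = H"
    and HH: "H * H = 1\<^sub>m ?N" and Hv: "H *\<^sub>v unit_vec ?N 0 = v"
    using householder_reflection_exists[OF v vv] by blast
  have Hv': "H *\<^sub>v v = unit_vec ?N 0"
    using H by (simp add: HH flip: Hv assoc_mult_mat_vec[OF H H])
  define B where "B = H * A * H"
  have B: "B \<in> carrier_mat ?N ?N" using A H by (simp add: B_def)
  have symB: "transpose_mat B = B"
    unfolding B_def using A H
    by (simp add: transpose_mult[of _ ?N ?N _ ?N] HT sym assoc_mult_mat[of _ ?N ?N _ ?N _ ?N])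
  have "B *\<^sub>v unit_vec ?N 0 = e \<cdot>\<^sub>v unit_vec ?N 0"
    unfolding B_def using A H v
    by (simp add: assoc_mult_mat_vec[of _ ?N ?N _ ?N] Hv ev mult_mat_vec Hv')
  then have Be: "(B *\<^sub>v unit_vec ?N 0) $ i = (e \<cdot>\<^sub>v unit_vec ?N 0) $ i" for i by simp
  have B0: "B $$ (i, 0) = (if i = 0 then e else 0)" if "i < ?N" for i
  proof -
    have "B $$ (i, 0) = (B *\<^sub>v unit_vec ?N 0) $ i" using that B by simp
    then show ?thesis using Be[of i] that by simp
  qed
  have B0': "B $$ (0, i) = (if i = 0 then e else 0)" if "i < ?N" for i
    using that B B0[OF that] arg_cong[OF symB, of "\<lambda>M. M $$ (0, i)"] by simp
  define A' where "A' = mat n n (\<lambda>(i,j). B $$ (Suc i, Suc j))"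
  have A': "A' \<in> carrier_mat n n" by (simp add: A'_def)
  have symA': "transpose_mat A' = A'"
  proof (rule eq_matI)
    fix i j assume "i < dim_row A'" "j < dim_col A'"
    then show "transpose_mat A' $$ (i, j) = A' $$ (i, j)"
      using B arg_cong[OF symB, of "\<lambda>M. M $$ (Suc i, Suc j)"] by (simp add: A'_def)
  qed (auto simp: A'_def)
  obtain U' \<alpha>' where U': "U' \<in> carrier_mat n n" and UU: "transpose_mat U' * U' = 1\<^sub>m n"
    "U' * transpose_mat U' = 1\<^sub>m n" and A'eq: "A' = U' * mat_diag n \<alpha>' * transpose_mat U'"
    using Suc.IH[OF A' symA'] unfolding orthogonally_diagonalizes_def by blast
  define \<alpha> where "\<alpha> = case_nat e \<alpha>'"
  define F where "F = four_block_mat (1\<^sub>m 1) (0\<^sub>m 1 n) (0\<^sub>m n 1) U'"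
  have F: "F \<in> carrier_mat ?N ?N" using U' unfolding F_def by (auto intro!: carrier_matI)
  have FT: "transpose_mat F = four_block_mat (1\<^sub>m 1) (0\<^sub>m 1 n) (0\<^sub>m n 1) (transpose_mat U')"
    unfolding F_def using U' by (subst transpose_four_block_mat) auto
  have D: "mat_diag ?N \<alpha> = four_block_mat (e \<cdot>\<^sub>m 1\<^sub>m 1) (0\<^sub>m 1 n) (0\<^sub>m n 1) (mat_diag n \<alpha>')"
    by (rule eq_matI) (auto simp: mat_diag_def \<alpha>_def split: nat.split)
  have FD: "F * mat_diag ?N \<alpha> =
      four_block_mat (e \<cdot>\<^sub>m 1\<^sub>m 1) (0\<^sub>m 1 n) (0\<^sub>m n 1) (U' * mat_diag n \<alpha>')"
    unfolding D F_def using U' left_mult_zero_mat[OF mat_diag_dim, of 1 n \<alpha>']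
    by (subst mult_four_block_mat[of _ 1 1 _ n _ n _ _ 1 _ n]) auto
  have "F * mat_diag ?N \<alpha> * transpose_mat F =
      four_block_mat (e \<cdot>\<^sub>m 1\<^sub>m 1) (0\<^sub>m 1 n) (0\<^sub>m n 1) A'"
    unfolding FD FT A'eq using U' right_mult_zero_mat[of "U' * mat_diag n \<alpha>'" n n 1]
      left_add_zero_mat[of "U' * mat_diag n \<alpha>' * transpose_mat U'" n n]
    by (subst mult_four_block_mat[of _ 1 1 _ n _ n _ _ 1 _ n]) auto
  also have "\<dots> = B"
    using B A' by (intro eq_matI) (auto simp: A'_def B0 B0')
  finally have FDF: "F * mat_diag ?N \<alpha> * transpose_mat F = B" .
  have FF: "transpose_mat F * F = 1\<^sub>m ?N" "F * transpose_mat F = 1\<^sub>m ?N"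
    unfolding FT unfolding F_def using U'
    by (subst mult_four_block_mat[of _ 1 1 _ n _ n _ _ 1 _ n]; auto simp: UU)+
  note [simp] = assoc_mult_mat[of _ ?N ?N _ ?N _ ?N]
  have TF: "transpose_mat F \<in> carrier_mat ?N ?N" using F by simp
  have D': "mat_diag ?N \<alpha> \<in> carrier_mat ?N ?N" by simp
  have cancelH: "H * (H * X) = X" if "X \<in> carrier_mat ?N ?N" for X
    using that H HH by (simp flip: assoc_mult_mat[of _ ?N ?N _ ?N _ ?N])
  have cancelF: "F * (transpose_mat F * X) = X" "transpose_mat F * (F * X) = X"
    if "X \<in> carrier_mat ?N ?N" for X
    using that F TF FF by (simp_all flip: assoc_mult_mat[of _ ?N ?N _ ?N _ ?N])
  have UT: "transpose_mat (H * F) = transpose_mat F * H"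
    using H F by (simp add: transpose_mult[of _ ?N ?N _ ?N] HT)
  have "transpose_mat (H * F) * (H * F) = 1\<^sub>m ?N"
    unfolding UT using H F TF by (simp add: cancelH FF)
  moreover have "(H * F) * transpose_mat (H * F) = 1\<^sub>m ?N"
    unfolding UT using H F TF by (simp add: cancelF HH)
  moreover have "(H * F) * mat_diag ?N \<alpha> * transpose_mat (H * F) = A"
  proof -
    have "(H * F) * mat_diag ?N \<alpha> * transpose_mat (H * F) =
        H * (F * mat_diag ?N \<alpha> * transpose_mat F) * H"
    proof -
      have FD: "F * mat_diag ?N \<alpha> \<in> carrier_mat ?N ?N" using F D' by (rule mult_carrier_mat)
      have HFD: "H * (F * mat_diag ?N \<alpha>) \<in> carrier_mat ?N ?N" using H FD by (rule mult_carrier_mat)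
      show ?thesis unfolding UT
        by (simp only: assoc_mult_mat[OF H F D'] assoc_mult_mat[OF H FD TF] flip: assoc_mult_mat[OF HFD TF H])
    qed
    also have "\<dots> = A" unfolding FDF B_def using H A by (simp add: cancelH HH)
    finally show ?thesis .
  qed
  ultimately show ?case unfolding orthogonally_diagonalizes_def using H F
    by (intro exI[of _ "H * F"] exI[of _ \<alpha>]) auto
qed


lemma orthogonally_diagonalizes_sorted:
  assumes "orthogonally_diagonalizes n U \<alpha> A"
  shows "\<exists>V \<beta>. orthogonally_diagonalizes n V \<beta> A \<and> sorted (map \<beta> [0..<n])"
proof -
  have U: "U \<in> carrier_mat n n" and UU: "transpose_mat U * U = 1\<^sub>m n" "U * transpose_mat U = 1\<^sub>m n"
    and A: "A = U * mat_diag n \<alpha> * transpose_mat U"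
    using assms unfolding orthogonally_diagonalizes_def by auto
  let ?l = "map \<alpha> [0..<n]"
  obtain p where p: "p permutes {..<n}" and pl: "permute_list p ?l = sort ?l"
    using mset_eq_permutation[of "sort ?l" ?l] by auto
  have pn: "p i < n" if "i < n" for i using permutes_in_image[OF p, of i] that by simp
  have pinj: "p i = p j \<longleftrightarrow> i = j" for i j using permutes_inj[OF p] by (auto dest: injD)
  define \<beta> where "\<beta> = \<alpha> \<circ> p"
  have "map \<beta> [0..<n] = permute_list p ?l"
    unfolding permute_list_def \<beta>_def using pn by auto
  then have srt: "sorted (map \<beta> [0..<n])" using pl by simp
  have reindex: "(\<Sum>k<n. f (p k)) = (\<Sum>k<n. f k)" for f :: "nat \<Rightarrow> real"
    using sum.permute[OF p, of f] by (simp add: comp_def)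
  define V where "V = mat n n (\<lambda>(i,j). U $$ (i, p j))"
  have V: "V \<in> carrier_mat n n" by (simp add: V_def)
  have "transpose_mat V * V = 1\<^sub>m n"
  proof (rule eq_matI)
    fix i j assume "i < dim_row (1\<^sub>m n)" "j < dim_col (1\<^sub>m n)"
    then have i: "i < n" and j: "j < n" by auto
    have "(transpose_mat V * V) $$ (i,j) = (transpose_mat U * U) $$ (p i, p j)"
      using i j pn U by (simp add: V_def scalar_prod_def)
    then show "(transpose_mat V * V) $$ (i,j) = 1\<^sub>m n $$ (i,j)"
      using i j pn by (simp add: UU pinj)
  qed (auto simp: V_def)
  moreover have "V * transpose_mat V = 1\<^sub>m n"
  proof (rule eq_matI)
    fix i j assume "i < dim_row (1\<^sub>m n)" "j < dim_col (1\<^sub>m n)"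
    then have i: "i < n" and j: "j < n" by auto
    have "(V * transpose_mat V) $$ (i,j) = (U * transpose_mat U) $$ (i, j)"
      using i j U reindex[of "\<lambda>k. U $$ (i,k) * U $$ (j,k)"]
      by (simp add: V_def scalar_prod_def atLeast0LessThan)
    then show "(V * transpose_mat V) $$ (i,j) = 1\<^sub>m n $$ (i,j)"
      by (simp add: UU)
  qed (auto simp: V_def)
  moreover have "A = V * mat_diag n \<beta> * transpose_mat V"
  proof (rule eq_matI)
    fix i j assume "i < dim_row (V * mat_diag n \<beta> * transpose_mat V)"
      "j < dim_col (V * mat_diag n \<beta> * transpose_mat V)"
    then have i: "i < n" and j: "j < n" using V by auto
    show "A $$ (i,j) = (V * mat_diag n \<beta> * transpose_mat V) $$ (i,j)"
      unfolding A mat_diag_mult_right[OF U] mat_diag_mult_right[OF V]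
      using i j U V pn reindex[of "\<lambda>k. U $$ (i,k) * \<alpha> k * U $$ (j,k)"]
      by (simp add: V_def scalar_prod_def atLeast0LessThan \<beta>_def)
  qed (use U in \<open>auto simp: V_def A\<close>)
  ultimately show ?thesis using V srt unfolding orthogonally_diagonalizes_def by blast
qed

text \<open>Orthogonal conjugation preserves the characteristic polynomial, which for a diagonal matrix is the
  product of the linear factors of its entries.\<close>

lemma nth_eigenvalue_orthogonally_diagonalizes:
  assumes "orthogonally_diagonalizes n U \<alpha> A"
  shows "nth_eigenvalue k A = sort (map \<alpha> [0..<n]) ! (k - 1)"
proof -
  have U: "U \<in> carrier_mat n n" and UU: "transpose_mat U * U = 1\<^sub>m n" "U * transpose_mat U = 1\<^sub>m n"
    and A: "A = U * mat_diag n \<alpha> * transpose_mat U"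
    using assms unfolding orthogonally_diagonalizes_def by auto
  have "similar_mat A (mat_diag n \<alpha>)"
    unfolding similar_mat_def
    by (intro exI, rule similar_mat_witI[OF UU(2) UU(1) A]) (use U A in auto)
  then have "char_poly A = (\<Prod>a\<leftarrow>diag_mat (mat_diag n \<alpha>). [:- a, 1:])"
    by (subst char_poly_similar, assumption, intro char_poly_upper_triangular[of _ n])
      (auto simp: mat_diag_def)
  also have "diag_mat (mat_diag n \<alpha>) = map \<alpha> [0..<n]"
    by (auto simp: diag_mat_def mat_diag_def)
  finally have cp: "char_poly A = (\<Prod>a\<leftarrow>map \<alpha> [0..<n]. [:- a, 1:])" .
  have "proots (\<Prod>a\<leftarrow>as. [:- a, 1:]) = mset as" for as :: "real list"
  proof (induction as)
    case (Cons a as)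
    have "(\<Prod>a\<leftarrow>as. [:- a, 1:]) \<noteq> 0" by (auto simp: prod_list_zero_iff)
    then have "proots ([:- a, 1:] * (\<Prod>a\<leftarrow>as. [:- a, 1:])) = {#a#} + mset as"
      using Cons by (subst proots_mult) auto
    then show ?case by simp
  qed simp
  then show ?thesis unfolding nth_eigenvalue_def cp by (simp only: sorted_list_of_multiset_mset)
qed

lemma nth_eigenvalue_sorted_diagonal:
  assumes "orthogonally_diagonalizes n U \<alpha> A" and "sorted (map \<alpha> [0..<n])" and "k \<in> {1..n}"
  shows "nth_eigenvalue k A = \<alpha> (k - 1)"
proof -
  have "k - 1 < n" using assms(3) by auto
  then show ?thesis
    using nth_eigenvalue_orthogonally_diagonalizes[OF assms(1), of k] assms(2)
    by (simp add: sorted_sort_id)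
qed

section \<open>Comparing eigenvalues through quadratic forms\<close>

text \<open>Filling up the \<open>k - 1\<close> equations in \<open>k\<close> unknowns with a zero row gives a singular square matrix.\<close>

lemma underdetermined_system_has_nontrivial_solution:
  fixes M :: "nat \<Rightarrow> nat \<Rightarrow> real"
  assumes "0 < k"
  shows "\<exists>c. (\<exists>i<k. c i \<noteq> 0) \<and> (\<forall>j<k - 1. (\<Sum>i<k. M j i * c i) = 0)"
proof -
  define N where "N = mat k k (\<lambda>(j,i). if j < k - 1 then M j i else 0)"
  have N: "N \<in> carrier_mat k k" by (simp add: N_def)
  have "transpose_mat N *\<^sub>v unit_vec k (k - 1) = 0\<^sub>v k"
    using assms by (intro eq_vecI) (auto simp: N_def)
  then have "det (transpose_mat N) = 0"
    using assms N
    by (subst det_0_iff_vec_prod_zero[of _ k]) (auto intro!: exI[of _ "unit_vec k (k - 1)"])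
  then have "det N = 0" using det_transpose[OF N] by simp
  then obtain v where v: "v \<in> carrier_vec k" "v \<noteq> 0\<^sub>v k" "N *\<^sub>v v = 0\<^sub>v k"
    using det_0_iff_vec_prod_zero[OF N] by blast
  have "\<exists>i<k. v $ i \<noteq> 0" using v(1,2) by (auto intro!: eq_vecI)
  moreover have "(\<Sum>i<k. M j i * v $ i) = 0" if "j < k - 1" for j
  proof -
    have "(N *\<^sub>v v) $ j = (\<Sum>i<k. M j i * v $ i)"
      using that v(1) by (simp add: N_def scalar_prod_def atLeast0LessThan)
    then show ?thesis using v(3) that by simp
  qed
  ultimately show ?thesis by blast
qed

lemma quadratic_form_orthogonally_diagonalizes:
  assumes "orthogonally_diagonalizes n U \<alpha> A" and x: "x \<in> carrier_vec n"
  shows "(A *\<^sub>v x) \<bullet> x = (\<Sum>j<n. \<alpha> j * ((transpose_mat U *\<^sub>v x) $ j)\<^sup>2)"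
    and "x \<bullet> x = (\<Sum>j<n. ((transpose_mat U *\<^sub>v x) $ j)\<^sup>2)"
proof -
  have U: "U \<in> carrier_mat n n" and UU: "U * transpose_mat U = 1\<^sub>m n"
    and A: "A = U * mat_diag n \<alpha> * transpose_mat U"
    using assms unfolding orthogonally_diagonalizes_def by auto
  let ?z = "transpose_mat U *\<^sub>v x"
  have UT: "transpose_mat U \<in> carrier_mat n n" using U by simp
  have z: "?z \<in> carrier_vec n" using U x by simp
  have move: "(U *\<^sub>v y) \<bullet> x = y \<bullet> ?z" if "y \<in> carrier_vec n" for y
    using transpose_vec_mult_scalar[OF UT x that] by simp
  have "A *\<^sub>v x = U *\<^sub>v (mat_diag n \<alpha> *\<^sub>v ?z)"
    unfolding A using U UT x by (simp add: assoc_mult_mat_vec[of _ n n _ n])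
  moreover have "mat_diag n \<alpha> *\<^sub>v ?z \<in> carrier_vec n"
    by (rule mult_mat_vec_carrier[OF mat_diag_dim z])
  ultimately have "(A *\<^sub>v x) \<bullet> x = (mat_diag n \<alpha> *\<^sub>v ?z) \<bullet> ?z"
    using move by simp
  also have "mat_diag n \<alpha> *\<^sub>v ?z = vec n (\<lambda>j. \<alpha> j * ?z $ j)"
    by (rule eq_vecI) (use U in \<open>auto simp: mat_diag_def scalar_prod_def if_distrib[of "\<lambda>a. a * _"] cong: if_cong\<close>)
  finally show "(A *\<^sub>v x) \<bullet> x = (\<Sum>j<n. \<alpha> j * (?z $ j)\<^sup>2)"
    using z U by (simp add: scalar_prod_def atLeast0LessThan power2_eq_square mult.assoc)
  have "U *\<^sub>v ?z = x" using U UT x UU by (simp flip: assoc_mult_mat_vec[OF U UT x])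
  then have "x \<bullet> x = ?z \<bullet> ?z" using move[OF z] by simp
  then show "x \<bullet> x = (\<Sum>j<n. (?z $ j)\<^sup>2)"
    using z U by (simp add: scalar_prod_def atLeast0LessThan power2_eq_square)
qed


text \<open>The argument of Courant and Fischer. The first \<open>k\<close> eigenvectors of \<open>B\<close> span a space of dimension
  \<open>k\<close>, and orthogonality of \<open>T x\<close> to the first \<open>k - 1\<close> eigenvectors of \<open>A\<close> imposes \<open>k - 1\<close> linear
  conditions on it. A nonzero solution \<open>x\<close> has Rayleigh quotient at most \<open>\<lambda>\<^sub>k(B)\<close>, its image
  has Rayleigh quotient at least \<open>\<lambda>\<^sub>k(A)\<close>, and the hypotheses compare the two quotients.
  As \<open>T\<close> need not be isometric but only expanding, the comparison of the denominators
  goes in the right direction because \<open>B\<close> is positive semidefinite.\<close>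

theorem nth_eigenvalue_le_of_form_pullback:
  fixes A B T :: "real mat"
  assumes A: "A \<in> carrier_mat n n" "transpose_mat A = A"
    and B: "B \<in> carrier_mat p p" "transpose_mat B = B"
    and T: "T \<in> carrier_mat n p" and "p \<le> n"
    and form: "\<And>x. x \<in> carrier_vec p \<Longrightarrow> (A *\<^sub>v (T *\<^sub>v x)) \<bullet> (T *\<^sub>v x) \<le> (B *\<^sub>v x) \<bullet> x"
    and psd: "\<And>x. x \<in> carrier_vec p \<Longrightarrow> 0 \<le> (B *\<^sub>v x) \<bullet> x"
    and expand: "\<And>x. x \<in> carrier_vec p \<Longrightarrow> x \<bullet> x \<le> (T *\<^sub>v x) \<bullet> (T *\<^sub>v x)"
    and k: "k \<in> {1..p}"
  shows "nth_eigenvalue k A \<le> nth_eigenvalue k B"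
proof -
  obtain U \<alpha> where UA: "orthogonally_diagonalizes n U \<alpha> A" and \<alpha>: "sorted (map \<alpha> [0..<n])"
    using real_symmetric_spectral[OF A] orthogonally_diagonalizes_sorted by blast
  obtain V \<beta> where VB: "orthogonally_diagonalizes p V \<beta> B" and \<beta>: "sorted (map \<beta> [0..<p])"
    using real_symmetric_spectral[OF B] orthogonally_diagonalizes_sorted by blast
  have U: "U \<in> carrier_mat n n" using UA by (simp add: orthogonally_diagonalizes_def)
  have V: "V \<in> carrier_mat p p" "transpose_mat V * V = 1\<^sub>m p"
    using VB by (simp_all add: orthogonally_diagonalizes_def)
  have eqA: "nth_eigenvalue k A = \<alpha> (k - 1)"
    by (rule nth_eigenvalue_sorted_diagonal[OF UA \<alpha>]) (use k \<open>p \<le> n\<close> in auto)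
  have eqB: "nth_eigenvalue k B = \<beta> (k - 1)"
    by (rule nth_eigenvalue_sorted_diagonal[OF VB \<beta> k])
  \<comment> \<open>The map \<open>T\<close> written in the two eigenbases.\<close>
  define M where "M = transpose_mat U * (T * V)"
  have UT: "transpose_mat U \<in> carrier_mat n n" and TV: "T * V \<in> carrier_mat n p"
    using U T V by auto
  have M: "M \<in> carrier_mat n p" unfolding M_def using UT TV by simp
  obtain c where c0: "\<exists>i<k. c i \<noteq> 0" and c: "\<And>j. j < k - 1 \<Longrightarrow> (\<Sum>i<k. M $$ (j,i) * c i) = 0"
    using underdetermined_system_has_nontrivial_solution[of k "\<lambda>j i. M $$ (j,i)"] k by auto
  define w where "w = vec p (\<lambda>i. if i < k then c i else 0)"
  have w: "w \<in> carrier_vec p" by (simp add: w_def)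
  define x where "x = V *\<^sub>v w"
  have x: "x \<in> carrier_vec p" using V w by (simp add: x_def)
  define z where "z = transpose_mat U *\<^sub>v (T *\<^sub>v x)"
  have Tx: "T *\<^sub>v x \<in> carrier_vec n" using T x by simp
  have coordx: "transpose_mat V *\<^sub>v x = w"
    unfolding x_def using V w by (simp flip: assoc_mult_mat_vec[of _ p p _ p])
  have zM: "z = M *\<^sub>v w"
    unfolding z_def x_def M_def using UT T V w
    by (simp add: assoc_mult_mat_vec[of _ n n _ p] assoc_mult_mat_vec[of _ n p _ p])
  have z0: "z $ j = 0" if "j < k - 1" for j
  proof -
    have "z $ j = (\<Sum>i<p. M $$ (j,i) * (if i < k then c i else 0))"
    proof -
      have "j < n" using that k \<open>p \<le> n\<close> by auto
      then show ?thesis unfolding zM using M by (simp add: w_def scalar_prod_def atLeast0LessThan)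
    qed
    also have "\<dots> = (\<Sum>i<k. M $$ (j,i) * c i)"
      using k by (intro sum.mono_neutral_cong_right) auto
    finally show ?thesis using c[OF that] by simp
  qed
  have formA: "(A *\<^sub>v (T *\<^sub>v x)) \<bullet> (T *\<^sub>v x) = (\<Sum>j<n. \<alpha> j * (z $ j)\<^sup>2)"
    and normA: "(T *\<^sub>v x) \<bullet> (T *\<^sub>v x) = (\<Sum>j<n. (z $ j)\<^sup>2)"
    using quadratic_form_orthogonally_diagonalizes[OF UA Tx] by (simp_all add: z_def)
  have formB: "(B *\<^sub>v x) \<bullet> x = (\<Sum>j<p. \<beta> j * (w $ j)\<^sup>2)"
    and normB: "x \<bullet> x = (\<Sum>j<p. (w $ j)\<^sup>2)"
    using quadratic_form_orthogonally_diagonalizes[OF VB x] by (simp_all add: coordx)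
  have "\<alpha> (k - 1) * ((T *\<^sub>v x) \<bullet> (T *\<^sub>v x)) \<le> (A *\<^sub>v (T *\<^sub>v x)) \<bullet> (T *\<^sub>v x)"
    unfolding formA normA sum_distrib_left
  proof (rule sum_mono)
    fix j assume j: "j \<in> {..<n}"
    show "\<alpha> (k - 1) * (z $ j)\<^sup>2 \<le> \<alpha> j * (z $ j)\<^sup>2"
    proof (cases "j < k - 1")
      case False
      then have "\<alpha> (k - 1) \<le> \<alpha> j" using sorted_nth_mono[OF \<alpha>, of "k - 1" j] j by simp
      then show ?thesis by (rule mult_right_mono) simp
    qed (simp add: z0)
  qed
  moreover have upper: "(B *\<^sub>v x) \<bullet> x \<le> \<beta> (k - 1) * (x \<bullet> x)"
    unfolding formB normB sum_distrib_left
  proof (rule sum_mono)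
    fix j assume j: "j \<in> {..<p}"
    show "\<beta> j * (w $ j)\<^sup>2 \<le> \<beta> (k - 1) * (w $ j)\<^sup>2"
    proof (cases "j < k")
      case True
      then have "\<beta> j \<le> \<beta> (k - 1)" using sorted_nth_mono[OF \<beta>, of j "k - 1"] k by simp
      then show ?thesis by (rule mult_right_mono) simp
    qed (use j in \<open>simp add: w_def\<close>)
  qed
  moreover have xpos: "x \<bullet> x > 0"
  proof -
    obtain i where i: "i < k" "c i \<noteq> 0" using c0 by blast
    then have "w $ i \<noteq> 0" "i < p" using k by (auto simp: w_def)
    then show ?thesis unfolding normB by (intro sum_pos2[of _ i]) auto
  qed
  moreover have "0 \<le> \<beta> (k - 1)"
    using psd[OF x] upper xpos by (smt (verit) mult_neg_pos)
  then have "\<beta> (k - 1) * (x \<bullet> x) \<le> \<beta> (k - 1) * ((T *\<^sub>v x) \<bullet> (T *\<^sub>v x))"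
    using expand[OF x] by (rule mult_left_mono[rotated])
  ultimately have "\<alpha> (k - 1) * ((T *\<^sub>v x) \<bullet> (T *\<^sub>v x)) \<le> \<beta> (k - 1) * ((T *\<^sub>v x) \<bullet> (T *\<^sub>v x))"
    using form[OF x] by linarith
  moreover have "0 < (T *\<^sub>v x) \<bullet> (T *\<^sub>v x)" using xpos expand[OF x] by linarith
  ultimately show ?thesis unfolding eqA eqB by (rule mult_right_le_imp_le)
qed

text \<open>Reflecting the spectrum at a point reverses its order, so the \<open>k\<close>th eigenvalue from below becomes
  the \<open>k\<close>th from above.\<close>

lemma nth_eigenvalue_scalar_minus:
  fixes A :: "real mat"
  assumes A: "A \<in> carrier_mat n n" "transpose_mat A = A" and k: "k \<in> {1..n}"
  shows "nth_eigenvalue k (c \<cdot>\<^sub>m 1\<^sub>m n - A) = c - nth_eigenvalue (n + 1 - k) A"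
proof -
  obtain U \<alpha> where UA: "orthogonally_diagonalizes n U \<alpha> A" and \<alpha>: "sorted (map \<alpha> [0..<n])"
    using real_symmetric_spectral[OF A] orthogonally_diagonalizes_sorted by blast
  then have U: "U \<in> carrier_mat n n" and UU: "transpose_mat U * U = 1\<^sub>m n" "U * transpose_mat U = 1\<^sub>m n"
    and Aeq: "A = U * mat_diag n \<alpha> * transpose_mat U"
    unfolding orthogonally_diagonalizes_def by auto
  have "c \<cdot>\<^sub>m 1\<^sub>m n - A = U * mat_diag n (\<lambda>j. c - \<alpha> j) * transpose_mat U"
  proof (rule eq_matI)
    fix i j assume "i < dim_row (U * mat_diag n (\<lambda>j. c - \<alpha> j) * transpose_mat U)"
      "j < dim_col (U * mat_diag n (\<lambda>j. c - \<alpha> j) * transpose_mat U)"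
    then have i: "i < n" and j: "j < n" using U by auto
    have "(\<Sum>k<n. U $$ (i,k) * U $$ (j,k)) = (U * transpose_mat U) $$ (i,j)"
      using i j U by (simp add: scalar_prod_def atLeast0LessThan)
    then have "c * (\<Sum>k<n. U $$ (i,k) * U $$ (j,k)) = (if i = j then c else 0)"
      using i j by (simp add: UU)
    then show "(c \<cdot>\<^sub>m 1\<^sub>m n - A) $$ (i,j) =
        (U * mat_diag n (\<lambda>j. c - \<alpha> j) * transpose_mat U) $$ (i,j)"
      unfolding Aeq mat_diag_mult_right[OF U] using i j U
      by (simp add: scalar_prod_def atLeast0LessThan algebra_simps sum_subtractf sum_distrib_left
          split: if_splits)
  qed (use U A in auto)
  then have dec: "orthogonally_diagonalizes n U (\<lambda>j. c - \<alpha> j) (c \<cdot>\<^sub>m 1\<^sub>m n - A)"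
    using U UU unfolding orthogonally_diagonalizes_def by simp
  have rev: "sort (map (\<lambda>j. c - \<alpha> j) [0..<n]) = rev (map (\<lambda>j. c - \<alpha> j) [0..<n])"
  proof (rule properties_for_sort)
    show "sorted (rev (map (\<lambda>j. c - \<alpha> j) [0..<n]))"
      using \<alpha> by (auto simp: sorted_iff_nth_mono rev_nth)
  qed simp
  have "nth_eigenvalue k (c \<cdot>\<^sub>m 1\<^sub>m n - A) = c - \<alpha> (n - k)"
  proof -
    have "k - 1 < n" "n - Suc (k - 1) = n - k" using k by auto
    then show ?thesis
      using nth_eigenvalue_orthogonally_diagonalizes[OF dec, of k] rev
      by (simp add: rev_nth)
  qed
  moreover have "nth_eigenvalue (n + 1 - k) A = \<alpha> (n - k)"
    using nth_eigenvalue_sorted_diagonal[OF UA \<alpha>, of "n + 1 - k"] k by fastforce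
  ultimately show ?thesis by simp
qed

lemma scalar_minus_quadratic_form:
  fixes A :: "real mat"
  assumes A: "A \<in> carrier_mat n n" and x: "x \<in> carrier_vec n"
  shows "((c \<cdot>\<^sub>m 1\<^sub>m n - A) *\<^sub>v x) \<bullet> x = c * (x \<bullet> x) - (A *\<^sub>v x) \<bullet> x"
proof -
  have "(c \<cdot>\<^sub>m 1\<^sub>m n - A) *\<^sub>v x = c \<cdot>\<^sub>v x - A *\<^sub>v x"
    using A x by (subst minus_mult_distrib_mat_vec[of _ n n]) auto
  then show ?thesis using A x by (simp add: minus_scalar_prod_distrib[of _ n])
qed

text \<open>The lower bound compares \<open>A\<close> and \<open>B\<close> along \<open>S\<close>; the upper bound is the same comparison for
  the reflected matrices \<open>c - A\<close> and \<open>c - B\<close> along a possibly different map \<open>T\<close>.\<close>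

theorem interlacesI_form_pullbacks:
  fixes A B S T :: "real mat"
  assumes A: "real_symmetric n A" and B: "real_symmetric p B" and p: "0 < p" "p < n"
    and S: "S \<in> carrier_mat n p" and T: "T \<in> carrier_mat n p"
    and lower_form: "\<And>x. x \<in> carrier_vec p \<Longrightarrow> (A *\<^sub>v (S *\<^sub>v x)) \<bullet> (S *\<^sub>v x) \<le> (B *\<^sub>v x) \<bullet> x"
    and lower_psd: "\<And>x. x \<in> carrier_vec p \<Longrightarrow> 0 \<le> (B *\<^sub>v x) \<bullet> x"
    and lower_norm: "\<And>x. x \<in> carrier_vec p \<Longrightarrow> x \<bullet> x \<le> (S *\<^sub>v x) \<bullet> (S *\<^sub>v x)"
    and upper_form: "\<And>x. x \<in> carrier_vec p \<Longrightarrow>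
      c * ((T *\<^sub>v x) \<bullet> (T *\<^sub>v x)) - (A *\<^sub>v (T *\<^sub>v x)) \<bullet> (T *\<^sub>v x) \<le> c * (x \<bullet> x) - (B *\<^sub>v x) \<bullet> x"
    and upper_psd: "\<And>x. x \<in> carrier_vec p \<Longrightarrow> (B *\<^sub>v x) \<bullet> x \<le> c * (x \<bullet> x)"
    and upper_norm: "\<And>x. x \<in> carrier_vec p \<Longrightarrow> x \<bullet> x \<le> (T *\<^sub>v x) \<bullet> (T *\<^sub>v x)"
  shows "interlaces B A"
proof -
  have A': "A \<in> carrier_mat n n" "transpose_mat A = A" and B': "B \<in> carrier_mat p p" "transpose_mat B = B"
    using A B by (auto simp: real_symmetric_def)
  have refl: "c \<cdot>\<^sub>m 1\<^sub>m m - C \<in> carrier_mat m m" "transpose_mat (c \<cdot>\<^sub>m 1\<^sub>m m - C) = c \<cdot>\<^sub>m 1\<^sub>m m - C"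
    if "C \<in> carrier_mat m m" "transpose_mat C = C" for C :: "real mat" and m
  proof -
    show "transpose_mat (c \<cdot>\<^sub>m 1\<^sub>m m - C) = c \<cdot>\<^sub>m 1\<^sub>m m - C"
    proof (rule eq_matI)
      fix i j assume "i < dim_row (c \<cdot>\<^sub>m 1\<^sub>m m - C)" "j < dim_col (c \<cdot>\<^sub>m 1\<^sub>m m - C)"
      then show "transpose_mat (c \<cdot>\<^sub>m 1\<^sub>m m - C) $$ (i,j) = (c \<cdot>\<^sub>m 1\<^sub>m m - C) $$ (i,j)"
        using that(1) arg_cong[OF that(2), of "\<lambda>M. M $$ (i,j)"] by auto
    qed (use that in auto)
  qed (use that in auto)
  have "nth_eigenvalue k A \<le> nth_eigenvalue k B" if "k \<in> {1..p}" for k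
    using nth_eigenvalue_le_of_form_pullback[OF A' B' S _ lower_form lower_psd lower_norm that] p by simp
  moreover have "nth_eigenvalue k B \<le> nth_eigenvalue (n - p + k) A" if k: "k \<in> {1..p}" for k
  proof -
    have "nth_eigenvalue (p + 1 - k) (c \<cdot>\<^sub>m 1\<^sub>m n - A) \<le> nth_eigenvalue (p + 1 - k) (c \<cdot>\<^sub>m 1\<^sub>m p - B)"
    proof (rule nth_eigenvalue_le_of_form_pullback[OF refl[OF A'] refl[OF B'] T])
      fix x :: "real vec" assume x: "x \<in> carrier_vec p"
      have Tx: "T *\<^sub>v x \<in> carrier_vec n" using T x by simp
      show "((c \<cdot>\<^sub>m 1\<^sub>m n - A) *\<^sub>v (T *\<^sub>v x)) \<bullet> (T *\<^sub>v x) \<le> ((c \<cdot>\<^sub>m 1\<^sub>m p - B) *\<^sub>v x) \<bullet> x"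
        unfolding scalar_minus_quadratic_form[OF A'(1) Tx] scalar_minus_quadratic_form[OF B'(1) x]
        by (rule upper_form[OF x])
      show "0 \<le> ((c \<cdot>\<^sub>m 1\<^sub>m p - B) *\<^sub>v x) \<bullet> x"
        unfolding scalar_minus_quadratic_form[OF B'(1) x] using upper_psd[OF x] by simp
      show "x \<bullet> x \<le> (T *\<^sub>v x) \<bullet> (T *\<^sub>v x)" by (rule upper_norm[OF x])
    qed (use p k in auto)
    moreover have "nth_eigenvalue (p + 1 - k) (c \<cdot>\<^sub>m 1\<^sub>m p - B) = c - nth_eigenvalue k B"
      using nth_eigenvalue_scalar_minus[OF B', of "p + 1 - k" c] k by fastforce
    moreover have "n + 1 - (p + 1 - k) = n - p + k" "p + 1 - k \<in> {1..n}" using p k by auto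
    then have "nth_eigenvalue (p + 1 - k) (c \<cdot>\<^sub>m 1\<^sub>m n - A) = c - nth_eigenvalue (n - p + k) A"
      using nth_eigenvalue_scalar_minus[OF A', of "p + 1 - k" c] by simp
    ultimately show ?thesis by simp
  qed
  ultimately show ?thesis unfolding interlaces_def using A B p by blast
qed

section \<open>Quadratic forms of the normalized Laplacian\<close>

lemma finite_edges: "simple_graph K \<Longrightarrow> finite (edges K)"
  unfolding simple_graph_def by (rule finite_subset[of _ "Pow (verts K)"]) auto

lemma adj_sym: "adj K u v \<longleftrightarrow> adj K v u"
  by (simp add: adj_def insert_commute)

lemma simple_graph_adjD:
  assumes "simple_graph K" and "adj K u v"
  shows "u \<in> verts K" and "v \<in> verts K" and "u \<noteq> v"
proof -
  obtain a b where "a \<in> verts K" "b \<in> verts K" "a \<noteq> b" "{u, v} = {a, b}"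
    using assms unfolding simple_graph_def adj_def by blast
  then show "u \<in> verts K" and "v \<in> verts K" and "u \<noteq> v" by (auto simp: doubleton_eq_iff)
qed

lemma finite_simple_cycles:
  assumes "simple_graph K"
  shows "finite (simple_cycles K)"
proof -
  have "simple_cycles K \<subseteq> (\<lambda>xs. xs @ [hd xs]) ` {xs. set xs \<subseteq> verts K \<and> distinct xs}"
    unfolding simple_cycles_def path_in_def by auto
  moreover have "finite {xs. set xs \<subseteq> verts K \<and> distinct xs}"
    using assms by (intro finite_subset_distinct) (simp add: simple_graph_def)
  ultimately show ?thesis by (meson finite_imageI finite_subset)
qed

lemma connected_graph_degree_pos:
  assumes K: "simple_graph K" and "connected_graph K" and "2 \<le> card (verts K)" and u: "u \<in> verts K"
  shows "0 < degree_of K u"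
proof -
  have "\<not> verts K \<subseteq> {u}" using assms(3) card_mono[of "{u}" "verts K"] by auto
  then obtain v where v: "v \<in> verts K" "v \<noteq> u" by auto
  then have "(u, v) \<in> connectivity K" using assms(2) u by (simp add: connected_graph_def)
  then have "(adj K)\<^sup>*\<^sup>* u v" by (simp add: connectivity_def)
  then obtain w where "adj K u w" using v(2) by (metis converse_rtranclpE)
  then have "w \<in> {v \<in> verts K. adj K u v}" using simple_graph_adjD[OF K] by auto
  moreover have "finite (verts K)" using K by (simp add: simple_graph_def)
  ultimately show ?thesis unfolding degree_of_def by (auto simp: card_gt_0_iff)
qed

lemma norm_laplacian_carrier: "norm_laplacian K vs \<in> carrier_mat (length vs) (length vs)"
  by (simp add: norm_laplacian_def)

lemma real_symmetric_norm_laplacian: "real_symmetric (length vs) (norm_laplacian K vs)"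
  unfolding real_symmetric_def
proof
  show "transpose_mat (norm_laplacian K vs) = norm_laplacian K vs"
    by (rule eq_matI) (auto simp: norm_laplacian_def Let_def adj_sym[of K] mult.commute)
qed (rule norm_laplacian_carrier)

lemma finite_adj:
  assumes K: "simple_graph K"
  shows "finite {(u,v). adj K u v}"
proof (rule finite_subset)
  show "{(u,v). adj K u v} \<subseteq> verts K \<times> verts K" using simple_graph_adjD[OF K] by auto
  show "finite (verts K \<times> verts K)" using K by (simp add: simple_graph_def)
qed

lemma sum_adj_iterated:
  fixes F :: "'b \<Rightarrow> 'b \<Rightarrow> real"
  assumes K: "simple_graph K"
  shows "(\<Sum>(u,v) | adj K u v. F u v) = (\<Sum>u\<in>verts K. \<Sum>v\<in>verts K. if adj K u v then F u v else 0)"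
proof -
  have fin: "finite (verts K)" using K by (simp add: simple_graph_def)
  have "(\<Sum>u\<in>verts K. \<Sum>v\<in>verts K. if adj K u v then F u v else 0) =
      (\<Sum>(u,v)\<in>verts K \<times> verts K. if adj K u v then F u v else 0)"
    by (rule sum.cartesian_product)
  also have "\<dots> = (\<Sum>(u,v) | adj K u v. F u v)"
    using fin simple_graph_adjD[OF K] by (intro sum.mono_neutral_cong_right) (auto split: if_splits)
  finally show ?thesis ..
qed

lemma sum_adj_swap:
  "(\<Sum>(u,v) | adj K u v. F u v) = (\<Sum>(u,v) | adj K u v. F v u)"
  by (rule sum.reindex_bij_witness[of _ prod.swap prod.swap]) (auto simp: adj_sym[of K])

text \<open>Edges are summed over as ordered pairs, so each vertex is counted once for every neighbour.\<close>

lemma sum_adj_degree: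
  fixes f :: "'b \<Rightarrow> real"
  assumes K: "simple_graph K"
  shows "(\<Sum>(u,v) | adj K u v. f u) = (\<Sum>u\<in>verts K. real (degree_of K u) * f u)"
proof -
  have "(\<Sum>v\<in>verts K. if adj K u v then f u else 0) = real (degree_of K u) * f u" for u
    using K by (simp add: degree_of_def simple_graph_def flip: sum.inter_filter)
  then show ?thesis unfolding sum_adj_iterated[OF K] by simp
qed

text \<open>Substituting \<open>x = sqrt d * g\<close> cancels the square roots in the off-diagonal entries. The divisions
  by \<open>2\<close> account for the two orientations of every edge. Positive degrees are what makes the
  substitution invertible: at an isolated vertex \<open>x\<close> would vanish.\<close>

lemma norm_laplacian_quadratic_form:
  fixes g :: "'b \<Rightarrow> real"
  assumes K: "simple_graph K" and vs: "distinct vs" "set vs = verts K"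
    and deg: "\<And>u. u \<in> verts K \<Longrightarrow> 0 < degree_of K u"
    and x: "x \<in> carrier_vec (length vs)"
    and xg: "\<And>i. i < length vs \<Longrightarrow> x $ i = sqrt (degree_of K (vs ! i)) * g (vs ! i)"
  shows "x \<bullet> x = (\<Sum>(u,v) | adj K u v. (g u)\<^sup>2)"
    and "(norm_laplacian K vs *\<^sub>v x) \<bullet> x = (\<Sum>(u,v) | adj K u v. (g u - g v)\<^sup>2) / 2"
    and "2 * (x \<bullet> x) - (norm_laplacian K vs *\<^sub>v x) \<bullet> x = (\<Sum>(u,v) | adj K u v. (g u + g v)\<^sup>2) / 2"
proof -
  let ?n = "length vs" and ?d = "\<lambda>u. real (degree_of K u)"
  have fin: "finite (verts K)" using K by (simp add: simple_graph_def)
  have enum: "(\<Sum>i<?n. f (vs ! i)) = (\<Sum>u\<in>verts K. f u)" for f :: "'b \<Rightarrow> real"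
    using sum.reindex_bij_betw[OF bij_betw_nth[OF vs(1) refl vs(2)[symmetric]], of f] by simp
  have "x \<bullet> x = (\<Sum>i<?n. ?d (vs ! i) * (g (vs ! i))\<^sup>2)"
    using x by (simp add: scalar_prod_def atLeast0LessThan xg power2_eq_square)
      (auto intro!: sum.cong simp flip: power2_eq_square simp: power_mult_distrib)
  then have norm: "x \<bullet> x = (\<Sum>u\<in>verts K. ?d u * (g u)\<^sup>2)"
    using enum[of "\<lambda>u. ?d u * (g u)\<^sup>2"] by simp
  then show norm': "x \<bullet> x = (\<Sum>(u,v) | adj K u v. (g u)\<^sup>2)"
    by (simp add: sum_adj_degree[OF K])
  define l where "l u v = (if u = v then 1 else if adj K u v then
    - inverse (sqrt (?d u * ?d v)) else 0)" for u v
  define y where "y u = sqrt (?d u) * g u" for u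
  have ly: "l u v * y v * y u = (if v = u then ?d u * (g u)\<^sup>2 else 0) - (if adj K u v then g u * g v else 0)"
    if "u \<in> verts K" "v \<in> verts K" for u v
  proof -
    have "?d u > 0" "?d v > 0" using deg that by auto
    moreover have "\<not> adj K u u" using simple_graph_adjD(3)[OF K] by blast
    ultimately show ?thesis
      by (auto simp: l_def y_def real_sqrt_mult field_simps power2_eq_square)
  qed
  have "(norm_laplacian K vs *\<^sub>v x) \<bullet> x = (\<Sum>i<?n. (\<Sum>j<?n. l (vs ! i) (vs ! j) * y (vs ! j)) * y (vs ! i))"
    using x by (auto simp: scalar_prod_def atLeast0LessThan norm_laplacian_def Let_def l_def y_def xg
        intro!: sum.cong)
  also have "\<dots> = (\<Sum>i<?n. (\<Sum>v\<in>verts K. l (vs ! i) v * y v) * y (vs ! i))"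
    by (intro sum.cong refl arg_cong2[where f = "(*)"] enum)
  also have "\<dots> = (\<Sum>u\<in>verts K. (\<Sum>v\<in>verts K. l u v * y v) * y u)"
    by (rule enum)
  also have "\<dots> = (\<Sum>u\<in>verts K. \<Sum>v\<in>verts K.
      (if v = u then ?d u * (g u)\<^sup>2 else 0) - (if adj K u v then g u * g v else 0))"
    unfolding sum_distrib_right by (intro sum.cong refl ly)
  also have "\<dots> = (\<Sum>u\<in>verts K. ?d u * (g u)\<^sup>2) - (\<Sum>(u,v) | adj K u v. g u * g v)"
    unfolding sum_adj_iterated[OF K] using fin by (simp add: sum_subtractf)
  finally have form: "(norm_laplacian K vs *\<^sub>v x) \<bullet> x = x \<bullet> x - (\<Sum>(u,v) | adj K u v. g u * g v)"
    by (simp add: norm)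
  have "(\<Sum>(u,v) | adj K u v. (g v)\<^sup>2) = x \<bullet> x"
    unfolding norm' by (rule sum_adj_swap)
  moreover have "(\<Sum>(u,v) | adj K u v. (g u + c * g v)\<^sup>2) = (\<Sum>(u,v) | adj K u v. (g u)\<^sup>2) +
      c\<^sup>2 * (\<Sum>(u,v) | adj K u v. (g v)\<^sup>2) + 2 * c * (\<Sum>(u,v) | adj K u v. g u * g v)" for c
    unfolding sum_distrib_left sum.distrib[symmetric]
    by (intro sum.cong) (auto simp: power2_eq_square algebra_simps)
  ultimately have sq: "(\<Sum>(u,v) | adj K u v. (g u + c * g v)\<^sup>2) =
      (1 + c\<^sup>2) * (x \<bullet> x) + 2 * c * (\<Sum>(u,v) | adj K u v. g u * g v)" for c
    by (simp add: norm' algebra_simps)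
  show "(norm_laplacian K vs *\<^sub>v x) \<bullet> x = (\<Sum>(u,v) | adj K u v. (g u - g v)\<^sup>2) / 2"
    using sq[of "-1"] form by simp
  show "2 * (x \<bullet> x) - (norm_laplacian K vs *\<^sub>v x) \<bullet> x = (\<Sum>(u,v) | adj K u v. (g u + g v)\<^sup>2) / 2"
    using sq[of 1] form by simp
qed

section \<open>Lists and paths\<close>

lemma successively_rtranclp:
  assumes "successively R xs" and "u \<in> set xs"
  shows "R\<^sup>*\<^sup>* (hd xs) u"
  using assms
proof (induction xs rule: induct_list012)
  case (3 x y zs)
  then show ?case by (auto intro: converse_rtranclp_into_rtranclp)
qed auto

text \<open>If the new starting vertex already occurs on the path, the path is cut short there.\<close>

lemma rtranclp_distinct_path:
  assumes "R\<^sup>*\<^sup>* a b"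
  shows "\<exists>xs. xs \<noteq> [] \<and> hd xs = a \<and> last xs = b \<and> distinct xs \<and> successively R xs"
  using assms
proof (induction rule: converse_rtranclp_induct)
  case base
  show ?case by (intro exI[of _ "[b]"]) simp
next
  case (step a c)
  then obtain xs where xs: "xs \<noteq> []" "hd xs = c" "last xs = b" "distinct xs" "successively R xs"
    by blast
  show ?case
  proof (cases "a \<in> set xs")
    case True
    then obtain ys zs where "xs = ys @ a # zs" by (auto dest: split_list)
    then show ?thesis using xs by (intro exI[of _ "a # zs"]) (auto simp: successively_append_iff)
  next
    case False
    then show ?thesis using xs step.hyps(1)
      by (intro exI[of _ "a # xs"]) (auto simp: successively_Cons)
  qed
qed

lemma remdups_append_constant:
  assumes "as \<noteq> []" and "\<And>a. a \<in> set as \<Longrightarrow> a = c" and "c \<notin> set bs"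
  shows "remdups (as @ bs) = c # remdups bs"
  using assms
proof (induction as)
  case (Cons a as)
  then show ?case by (cases "as = []") (auto intro: list.set_intros(1) dest: hd_in_set)
qed simp

section \<open>The quotient by a set of contracted edges\<close>

locale edge_contraction =
  fixes G :: "'a graph" and Ecs :: "'a set set" and cells :: "'a set list"
  assumes simple: "simple_graph G"
    and Ecs_edges: "Ecs \<subseteq> edges G"
    and distinct_cells: "distinct cells"
    and set_cells: "set cells = contraction_partition G Ecs"
begin

abbreviation contracted_adj :: "'a \<Rightarrow> 'a \<Rightarrow> bool" where
  "contracted_adj u v \<equiv> {u, v} \<in> Ecs"

abbreviation quotient :: "nat graph" where
  "quotient \<equiv> contraction G cells"

text \<open>The quotient map; its values are the indices that serve as vertices of the contraction.\<close>

definition cell :: "'a \<Rightarrow> nat" where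
  "cell u = (THE i. i < length cells \<and> u \<in> cells ! i)"

lemmas adjD = simple_graph_adjD[OF simple]

lemma contracted_adj_adj: "contracted_adj u v \<Longrightarrow> adj G u v"
  using Ecs_edges by (auto simp: adj_def)

lemma contracted_reach_verts: "contracted_adj\<^sup>*\<^sup>* u v \<Longrightarrow> u \<in> verts G \<Longrightarrow> v \<in> verts G"
  by (induction rule: rtranclp_induct) (auto dest: contracted_adj_adj adjD)

lemma contracted_reach_sym: "contracted_adj\<^sup>*\<^sup>* u v \<Longrightarrow> contracted_adj\<^sup>*\<^sup>* v u"
proof (induction rule: rtranclp_induct)
  case (step y z)
  then have "contracted_adj z y" by (simp add: insert_commute)
  then show ?case using step.IH by (rule converse_rtranclp_into_rtranclp)
qed simp

definition contracted_connectivity :: "('a \<times> 'a) set" where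
  "contracted_connectivity = {(u, v). u \<in> verts G \<and> v \<in> verts G \<and> contracted_adj\<^sup>*\<^sup>* u v}"

lemma equiv_contracted_connectivity: "equiv (verts G) contracted_connectivity"
  unfolding contracted_connectivity_def
  by (intro equivI refl_onI symI transI) (auto intro: contracted_reach_sym rtranclp_trans)

lemma set_cells_quotient: "set cells = verts G // contracted_connectivity"
  unfolding set_cells contraction_partition_def components_def connectivity_def
    contracted_connectivity_def adj_def by simp

lemma cell_unique:
  assumes "i < length cells" "j < length cells" "u \<in> cells ! i" "u \<in> cells ! j"
  shows "i = j"
proof -
  have "cells ! i \<in> verts G // contracted_connectivity" "cells ! j \<in> verts G // contracted_connectivity"
    using assms set_cells_quotient nth_mem by blast+
  then have "cells ! i = cells ! j"
    using quotient_disj[OF equiv_contracted_connectivity] assms(3,4) by blast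
  then show ?thesis using assms distinct_cells nth_eq_iff_index_eq by blast
qed

lemma cell_eqI: "i < length cells \<Longrightarrow> u \<in> cells ! i \<Longrightarrow> cell u = i"
  unfolding cell_def using cell_unique by (intro the_equality) auto

lemma cell_less: "u \<in> verts G \<Longrightarrow> cell u < length cells"
  and in_cell: "u \<in> verts G \<Longrightarrow> u \<in> cells ! cell u"
proof -
  assume u: "u \<in> verts G"
  then have "u \<in> \<Union> (set cells)"
    unfolding set_cells_quotient Union_quotient[OF equiv_contracted_connectivity] .
  then obtain i where "i < length cells" "u \<in> cells ! i" by (auto simp: in_set_conv_nth)
  with cell_eqI show "cell u < length cells" "u \<in> cells ! cell u" by auto
qed

lemma cell_subset_verts: "i < length cells \<Longrightarrow> cells ! i \<subseteq> verts G"
  using Union_quotient[OF equiv_contracted_connectivity] nth_mem unfolding set_cells_quotient[symmetric]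
  by fastforce

lemma cell_nonempty: "i < length cells \<Longrightarrow> cells ! i \<noteq> {}"
  using in_quotient_imp_non_empty[OF equiv_contracted_connectivity] nth_mem
  unfolding set_cells_quotient[symmetric] by blast

lemma cell_surj:
  assumes "i < length cells"
  shows "\<exists>u \<in> verts G. cell u = i"
  using assms cell_eqI cell_subset_verts cell_nonempty by (metis equals0I subsetD)

lemma cell_eq_iff:
  assumes u: "u \<in> verts G" and v: "v \<in> verts G"
  shows "cell u = cell v \<longleftrightarrow> contracted_adj\<^sup>*\<^sup>* u v"
proof -
  have q: "cells ! cell u \<in> verts G // contracted_connectivity"
    using cell_less[OF u] set_cells_quotient nth_mem by blast
  have "contracted_adj\<^sup>*\<^sup>* u v \<longleftrightarrow> (u, v) \<in> contracted_connectivity"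
    using u v by (simp add: contracted_connectivity_def)
  also have "\<dots> \<longleftrightarrow> v \<in> cells ! cell u"
    using q in_cell[OF u] quotient_eqI quotient_eq_iff
    by (metis equiv_contracted_connectivity in_quotient_imp_closed in_quotient_imp_in_rel insert_subset empty_subsetI)
  also have "\<dots> \<longleftrightarrow> cell u = cell v"
    using cell_eqI[OF cell_less[OF u], of v] in_cell[OF v] by auto
  finally show ?thesis ..
qed

lemma contracted_adj_same_cell: "contracted_adj u v \<Longrightarrow> cell u = cell v"
  using cell_eq_iff adjD contracted_adj_adj by blast

text \<open>The quotient as a graph homomorphism: its edges are the images of the edges of \<open>G\<close> that are not
  collapsed to a point.\<close>

lemma adj_quotient_iff:
  "adj quotient i j \<longleftrightarrow> (\<exists>u v. adj G u v \<and> cell u = i \<and> cell v = j \<and> i \<noteq> j)"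
proof
  assume "adj quotient i j"
  then obtain k l where kl: "{i, j} = {k, l}" "k < length cells" "l < length cells" "k \<noteq> l"
    and e: "\<exists>u \<in> cells ! k. \<exists>v \<in> cells ! l. adj G u v"
    unfolding adj_def contraction_def by auto
  from e obtain u v where "u \<in> cells ! k" "v \<in> cells ! l" "adj G u v" by blast
  then have "adj G u v" "adj G v u" "cell u = k" "cell v = l"
    using kl cell_eqI by (auto simp: adj_sym[of G v u])
  with kl show "\<exists>u v. adj G u v \<and> cell u = i \<and> cell v = j \<and> i \<noteq> j"
    by (metis doubleton_eq_iff)
next
  assume "\<exists>u v. adj G u v \<and> cell u = i \<and> cell v = j \<and> i \<noteq> j"
  then obtain u v where uv: "adj G u v" "cell u = i" "cell v = j" "i \<noteq> j" by blast
  then have "i < length cells" "j < length cells" "u \<in> cells ! i" "v \<in> cells ! j"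
    using cell_less in_cell adjD by blast+
  with uv have "\<exists>k l. {i, j} = {k, l} \<and> k < length cells \<and> l < length cells \<and> k \<noteq> l \<and>
      (\<exists>u \<in> cells ! k. \<exists>v \<in> cells ! l. adj G u v)" by blast
  then show "adj quotient i j"
    unfolding adj_def contraction_def by simp
qed

lemma verts_quotient: "verts quotient = {..<length cells}"
  by (simp add: contraction_def)

lemma simple_quotient: "simple_graph quotient"
  unfolding simple_graph_def contraction_def by auto

lemma connected_quotient:
  assumes "connected_graph G"
  shows "connected_graph quotient"
proof -
  have step: "(adj quotient)\<^sup>*\<^sup>* (cell u) (cell v)" if "(adj G)\<^sup>*\<^sup>* u v" for u v
    using that
  proof (induction rule: rtranclp_induct)
    case (step y z)
    show ?case
    proof (cases "cell y = cell z")
      case False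
      then have "adj quotient (cell y) (cell z)" using step.hyps(2) adj_quotient_iff by blast
      with step.IH show ?thesis by (rule rtranclp.rtrancl_into_rtrancl)
    qed (use step.IH in simp)
  qed simp
  have "(adj quotient)\<^sup>*\<^sup>* i j" if ij: "i < length cells" "j < length cells" for i j
  proof -
    obtain u v where "u \<in> verts G" "v \<in> verts G" "cell u = i" "cell v = j"
      using cell_surj[OF ij(1)] cell_surj[OF ij(2)] by blast
    moreover then have "(adj G)\<^sup>*\<^sup>* u v"
      using assms by (auto simp: connected_graph_def connectivity_def set_eq_iff)
    ultimately show ?thesis using step by blast
  qed
  then show ?thesis unfolding connected_graph_def connectivity_def verts_quotient by auto
qed

section \<open>Lifting cycles of the quotient\<close>

lemma contracted_path_same_cell:
  assumes "successively contracted_adj xs" and "hd xs \<in> verts G" and "u \<in> set xs"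
  shows "u \<in> verts G" and "cell u = cell (hd xs)"
proof -
  have "contracted_adj\<^sup>*\<^sup>* (hd xs) u"
    using successively_rtranclp[of contracted_adj xs u] assms by blast
  moreover then show "u \<in> verts G" using contracted_reach_verts assms(2) by blast
  ultimately show "cell u = cell (hd xs)" using cell_eq_iff[OF assms(2)] by metis
qed

lemma path_within_cell:
  assumes "x \<in> verts G" and "y \<in> verts G" and "cell x = cell y"
  shows "\<exists>xs. path_in G xs \<and> hd xs = x \<and> last xs = y \<and> (\<forall>u \<in> set xs. cell u = cell x)"
proof -
  have "contracted_adj\<^sup>*\<^sup>* x y" using assms cell_eq_iff by blast
  then obtain xs where xs: "xs \<noteq> []" "hd xs = x" "last xs = y" "distinct xs"
    "successively contracted_adj xs"
    using rtranclp_distinct_path[of contracted_adj x y] by blast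
  have "successively (adj G) xs"
    using xs(5) by (rule successively_mono) (auto intro: contracted_adj_adj)
  then show ?thesis
    using xs contracted_path_same_cell[OF xs(5)] assms(1) unfolding path_in_def by auto
qed

text \<open>Each edge of the path is replaced by an edge over it, and the gap between two consecutive such
  edges is closed by a path inside their common cell. The lift stays in one cell until it leaves it
  for good, so deleting repetitions from its projection gives back the path. Both endpoints
  can be prescribed, which is what makes it possible to lift cycles.\<close>

lemma quotient_path_lifts:
  assumes "ys \<noteq> []" and "path_in quotient ys"
    and "x \<in> verts G" and "cell x = hd ys" and "y \<in> verts G" and "cell y = last ys"
  shows "\<exists>xs. path_in G xs \<and> hd xs = x \<and> last xs = y \<and> remdups (map cell xs) = ys"
  using assms
proof (induction ys arbitrary: x rule: list_nonempty_induct)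
  case (single c)
  then obtain xs where xs: "path_in G xs" "hd xs = x" "last xs = y" "\<forall>u \<in> set xs. cell u = c"
    using path_within_cell[of x y] by auto
  then show ?case using remdups_append_constant[of "map cell xs" c "[]"]
    by (intro exI[of _ xs]) (auto simp: path_in_def)
next
  case (cons c ys)
  have c: "c \<notin> set ys" "path_in quotient ys" "adj quotient c (hd ys)"
    using cons.prems(1) cons.hyps by (auto simp: path_in_def successively_Cons)
  obtain u w where uw: "adj G u w" "cell u = c" "cell w = hd ys"
    using c(3) unfolding adj_quotient_iff by blast
  obtain xs where xs: "path_in G xs" "hd xs = w" "last xs = y" "remdups (map cell xs) = ys"
    using cons.IH[OF c(2) adjD(2)[OF uw(1)] uw(3) cons.prems(4)] cons.prems(5) cons.hyps by auto
  obtain zs where zs: "path_in G zs" "hd zs = x" "last zs = u" "\<forall>u \<in> set zs. cell u = c"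
    using path_within_cell[of x u] cons.prems(2,3) adjD(1)[OF uw(1)] uw(2) by auto
  have cxs: "cell ` set xs = set ys" using xs(4) by (metis set_map set_remdups)
  have "set zs \<inter> set xs = {}" using cxs c(1) zs(4) by auto
  then have "path_in G (zs @ xs)"
    using xs zs uw(1) unfolding path_in_def by (auto simp: successively_append_iff)
  moreover have "remdups (map cell (zs @ xs)) = c # ys"
    using remdups_append_constant[of "map cell zs" c "map cell xs"] zs(1,4) xs(4) c(1) cxs
    by (auto simp: path_in_def)
  moreover have "hd (zs @ xs) = x" "last (zs @ xs) = y"
    using zs xs by (auto simp: path_in_def)
  ultimately show ?case by blast
qed

text \<open>The lift of a cycle of the quotient starts where the lifted closing edge arrives and ends where
  that edge departs, hence in two different cells. So every cycle of the quotient is the projection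
  of a member of the set \<open>S\<close> of cycles whose closing edge runs between different cells. If some cycle of \<open>G\<close>
  were outside \<open>S\<close>, then \<open>G\<close> would have strictly more cycles than the quotient.\<close>

lemma cycle_invariant_cycle_crosses_cells:
  assumes inv: "cycle_invariant G cells"
    and xs: "path_in G xs" "3 \<le> length xs" "adj G (last xs) (hd xs)"
  shows "cell (hd xs) \<noteq> cell (last xs)"
proof
  assume same: "cell (hd xs) = cell (last xs)"
  define S where "S = {zs \<in> simple_cycles G. cell (hd (butlast zs)) \<noteq> cell (last (butlast zs))}"
  define proj where "proj zs = (let ys = remdups (map cell (butlast zs)) in ys @ [hd ys])" for zs
  have fin: "finite (simple_cycles G)" by (rule finite_simple_cycles[OF simple])
  have "simple_cycles quotient \<subseteq> proj ` S"
  proof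
    fix c assume "c \<in> simple_cycles quotient"
    then obtain ys where c: "c = ys @ [hd ys]" and ys: "path_in quotient ys" "3 \<le> length ys"
      "adj quotient (last ys) (hd ys)" unfolding simple_cycles_def by blast
    obtain u w where uw: "adj G u w" "cell u = last ys" "cell w = hd ys" "hd ys \<noteq> last ys"
      using ys(3) unfolding adj_quotient_iff by force
    obtain zs where zs: "path_in G zs" "hd zs = w" "last zs = u" "remdups (map cell zs) = ys"
      using quotient_path_lifts[of ys w u] ys uw adjD[OF uw(1)] by (auto simp: path_in_def)
    have "3 \<le> length zs" using ys(2) zs(4) length_remdups_leq[of "map cell zs"] by simp
    then have "zs @ [hd zs] \<in> S"
      unfolding S_def simple_cycles_def using zs uw by auto
    moreover have "proj (zs @ [hd zs]) = c" by (simp add: proj_def c zs(4) Let_def)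
    ultimately show "c \<in> proj ` S" by blast
  qed
  then have "card (simple_cycles quotient) \<le> card S"
    using fin by (intro surj_card_le) (auto simp: S_def)
  also have "\<dots> < card (simple_cycles G)"
  proof (rule psubset_card_mono[OF fin])
    have "xs @ [hd xs] \<in> simple_cycles G - S"
      using xs same by (auto simp: simple_cycles_def S_def)
    then show "S \<subset> simple_cycles G" unfolding S_def by blast
  qed
  also have "card (simple_cycles G) = card (simple_cycles quotient)"
    using inv bij_betw_same_card unfolding cycle_invariant_def by blast
  finally show False by simp
qed

definition avoiding :: "'a set \<Rightarrow> 'a \<Rightarrow> 'a \<Rightarrow> bool" where
  "avoiding e u v \<longleftrightarrow> adj G u v \<and> {u, v} \<noteq> e"

text \<open>A path that joins the endpoints of a contracted edge without using the edge becomes a cycle whose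
  closing edge is that edge and thus stays inside a cell.\<close>

lemma cycle_invariant_contracted_bridge:
  assumes inv: "cycle_invariant G cells" and ab: "contracted_adj a b"
  shows "\<not> (avoiding {a, b})\<^sup>*\<^sup>* a b"
proof
  assume "(avoiding {a, b})\<^sup>*\<^sup>* a b"
  then obtain xs where xs: "xs \<noteq> []" "hd xs = a" "last xs = b" "distinct xs"
    "successively (avoiding {a, b}) xs"
    using rtranclp_distinct_path[of "avoiding {a, b}" a b] by blast
  have adjab: "adj G a b" using ab by (rule contracted_adj_adj)
  have suc: "successively (adj G) xs"
    using xs(5) by (rule successively_mono) (auto simp: avoiding_def)
  have "(adj G)\<^sup>*\<^sup>* a u \<Longrightarrow> u \<in> verts G" for u
    by (induction rule: rtranclp_induct) (use adjab in \<open>auto dest: adjD\<close>)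
  then have "path_in G xs"
    unfolding path_in_def using xs suc successively_rtranclp[OF suc] by auto
  \<comment> \<open>A path with only two vertices would be the avoided edge itself.\<close>
  moreover have "3 \<le> length xs"
  proof (rule ccontr)
    assume "\<not> 3 \<le> length xs"
    moreover have "0 < length xs" using xs(1) by simp
    ultimately consider "length xs = 1" | "length xs = 2" by linarith
    then show False
    proof cases
      case 1
      then show False using xs adjD(3)[OF adjab] by (auto simp: length_Suc_conv)
    next
      case 2
      then have "xs = [a, b]" using xs by (auto simp: length_Suc_conv numeral_2_eq_2)
      then show False using xs(5) by (simp add: avoiding_def)
    qed
  qed
  ultimately have "cell a \<noteq> cell b"
    using cycle_invariant_cycle_crosses_cells[OF inv, of xs] xs adjab by (simp add: adj_sym[of G b])
  then show False using contracted_adj_same_cell[OF ab] by simp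
qed

end

section \<open>Contracting bridges\<close>

text \<open>Cycle-invariance enters the comparison of the spectra only through this property.\<close>

locale bridge_contraction = edge_contraction +
  assumes bridge: "contracted_adj a b \<Longrightarrow> \<not> (avoiding {a, b})\<^sup>*\<^sup>* a b"
begin

text \<open>Deleting a bridge disconnects its endpoints; \<open>side e u\<close> says whether \<open>u\<close> is still connected to the
  endpoint of \<open>e\<close> that is chosen here.\<close>

definition side :: "'a set \<Rightarrow> 'a \<Rightarrow> bool" where
  "side e u \<longleftrightarrow> (avoiding e)\<^sup>*\<^sup>* (SOME a. a \<in> e) u"

lemma side_eq:
  assumes "adj G u v" and "{u, v} \<noteq> e"
  shows "side e u = side e v"
proof -
  have "avoiding e u v" "avoiding e v u"
    using assms by (auto simp: avoiding_def adj_sym[of G v u] insert_commute)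
  then show ?thesis unfolding side_def by (auto intro: rtranclp.rtrancl_into_rtrancl)
qed

lemma side_neq:
  assumes "contracted_adj u v"
  shows "side {u, v} u \<noteq> side {u, v} v"
proof -
  have "(SOME a. a \<in> {u, v}) \<in> {u, v}" by (rule someI[of _ u]) simp
  then consider "(SOME a. a \<in> {u, v}) = u" | "(SOME a. a \<in> {u, v}) = v" by blast
  then show ?thesis
  proof cases
    case 1
    then show ?thesis unfolding side_def using bridge[OF assms] by simp
  next
    case 2
    then show ?thesis unfolding side_def using bridge[of v u] assms by (simp add: insert_commute)
  qed
qed

lemma side_constant_on_path:
  assumes "successively contracted_adj xs" and "xs \<noteq> []" and "u \<in> e" and "u \<notin> set xs"
  shows "side e (hd xs) = side e (last xs)"
  using assms
proof (induction xs rule: induct_list012)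
  case (3 x y zs)
  then have "contracted_adj x y" "{x, y} \<noteq> e" by auto
  then have "side e x = side e y" by (intro side_eq contracted_adj_adj)
  moreover have "side e y = side e (last (y # zs))" using "3.IH"(2) "3.prems" by simp
  ultimately show ?case by simp
qed auto

text \<open>The first edge of a simple path inside the cell is crossed only once.\<close>

lemma contracted_bridge_separates:
  assumes u: "u \<in> verts G" and v: "v \<in> verts G" and "cell u = cell v" and "u \<noteq> v"
  shows "\<exists>e \<in> Ecs. side e u \<noteq> side e v"
proof -
  have "contracted_adj\<^sup>*\<^sup>* u v" using assms cell_eq_iff by blast
  then obtain xs where xs: "xs \<noteq> []" "hd xs = u" "last xs = v" "distinct xs"
    "successively contracted_adj xs"
    using rtranclp_distinct_path[of contracted_adj u v] by blast
  then obtain ys where "xs = u # ys" by (cases xs) auto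
  with xs \<open>u \<noteq> v\<close> have ys: "xs = u # ys" "ys \<noteq> []" by auto
  let ?e = "{u, hd ys}"
  have e: "?e \<in> Ecs" and suc: "successively contracted_adj ys"
    using xs(5) ys by (auto simp: successively_Cons)
  have "side ?e (hd ys) = side ?e (last ys)"
    using xs(4) ys by (intro side_constant_on_path[OF suc, of u]) auto
  then have "side ?e u \<noteq> side ?e v" using side_neq[OF e] xs(3) ys by simp
  with e show ?thesis by blast
qed

text \<open>The side of \<open>e\<close> changes only across \<open>e\<close>, so a path within a cell along which it changes contains \<open>e\<close>.\<close>

lemma side_change_in_cell:
  assumes "contracted_adj\<^sup>*\<^sup>* u v" and "u \<in> verts G" and "side e u \<noteq> side e v" and "a \<in> e"
  shows "cell a = cell u"
  using assms
proof (induction rule: rtranclp_induct)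
  case (step y z)
  show ?case
  proof (cases "side e u = side e y")
    case True
    then have "side e y \<noteq> side e z" using step.prems(2) by simp
    then have "{y, z} = e" using side_eq[OF contracted_adj_adj[OF step.hyps(2)]] by blast
    moreover have "cell u = cell y"
      using cell_eq_iff[OF step.prems(1) contracted_reach_verts[OF step.hyps(1) step.prems(1)]]
        step.hyps(1) by blast
    moreover have "cell y = cell z" using step.hyps(2) by (rule contracted_adj_same_cell)
    ultimately show ?thesis using step.prems(3) by auto
  next
    case False
    then show ?thesis using step.IH step.prems by blast
  qed
qed simp

text \<open>Suppose that two parallel edges join the same pair of cells and that a bridge \<open>e\<close> inside the first
  cell separates their endpoints there. The edges themselves do not cross \<open>e\<close>, so \<open>e\<close> separates the
  endpoints in the second cell as well and would have to lie in both cells.\<close>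

lemma cross_edge_unique_endpoint:
  assumes uv: "adj G u v" and uv': "adj G u' v'"
    and cells: "cell u = cell u'" "cell v = cell v'" "cell u \<noteq> cell v"
  shows "u = u'"
proof (rule ccontr)
  assume "u \<noteq> u'"
  then obtain e where e: "e \<in> Ecs" "side e u \<noteq> side e u'"
    using contracted_bridge_separates[OF adjD(1)[OF uv] adjD(1)[OF uv'] cells(1)] by blast
  have ne: "{u, v} \<noteq> e" "{u', v'} \<noteq> e"
    using e(1) contracted_adj_same_cell[of u v] contracted_adj_same_cell[of u' v'] cells by auto
  have side_v: "side e v \<noteq> side e v'"
    using side_eq[OF uv ne(1)] side_eq[OF uv' ne(2)] e(2) by simp
  have "contracted_adj\<^sup>*\<^sup>* u u'"
    using cells(1) cell_eq_iff[OF adjD(1)[OF uv] adjD(1)[OF uv']] by blast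
  then have "cell a = cell u" if "a \<in> e" for a
    using side_change_in_cell[OF _ adjD(1)[OF uv] e(2) that] by blast
  moreover have "contracted_adj\<^sup>*\<^sup>* v v'"
    using cells(2) cell_eq_iff[OF adjD(2)[OF uv] adjD(2)[OF uv']] by blast
  then have "cell a = cell v" if "a \<in> e" for a
    using side_change_in_cell[OF _ adjD(2)[OF uv] side_v that] by blast
  moreover obtain a where "a \<in> e" using e(1) Ecs_edges simple unfolding simple_graph_def by blast
  ultimately show False using cells(3) by metis
qed

lemma cross_edge_unique:
  assumes "adj G u v" and "adj G u' v'"
    and "cell u = cell u'" and "cell v = cell v'" and "cell u \<noteq> cell v"
  shows "u = u' \<and> v = v'"
proof
  show "u = u'" using assms by (rule cross_edge_unique_endpoint)
  have "adj G v u" using assms(1) by (subst adj_sym)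
  moreover have "adj G v' u'" using assms(2) by (subst adj_sym)
  ultimately show "v = v'" using assms(4,3) assms(5)[symmetric] by (rule cross_edge_unique_endpoint)
qed

lemma adj_same_cell_contracted:
  assumes "adj G u v" and "cell u = cell v"
  shows "contracted_adj u v"
proof (rule ccontr)
  assume uncontracted: "\<not> contracted_adj u v"
  obtain e where e: "e \<in> Ecs" "side e u \<noteq> side e v"
    using contracted_bridge_separates[OF adjD(1,2)[OF assms(1)] assms(2) adjD(3)[OF assms(1)]] by blast
  then have "{u, v} \<noteq> e" using uncontracted by auto
  then show False using side_eq[OF assms(1)] e(2) by simp
qed

text \<open>Crossing a contracted edge changes the factor of that edge and no other factor; crossing any
  other edge changes none.\<close>

definition switching :: "'a \<Rightarrow> real" where
  "switching u = (\<Prod>e\<in>Ecs. if side e u then 1 else -1)"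

lemma finite_Ecs: "finite Ecs"
  using finite_edges[OF simple] Ecs_edges finite_subset by blast

lemma switching_square: "(switching u)\<^sup>2 = 1"
  unfolding switching_def prod_power_distrib by (intro prod.neutral) auto

lemma switching_same:
  assumes "adj G u v" and "cell u \<noteq> cell v"
  shows "switching u = switching v"
proof -
  have "side e u = side e v" if "e \<in> Ecs" for e
  proof (rule side_eq[OF assms(1)])
    show "{u, v} \<noteq> e" using contracted_adj_same_cell[of u v] assms(2) that by auto
  qed
  then show ?thesis unfolding switching_def by (intro prod.cong) auto
qed

lemma switching_flip:
  assumes "adj G u v" and "cell u = cell v"
  shows "switching u = - switching v"
proof -
  let ?e = "{u, v}"
  have e: "?e \<in> Ecs" using adj_same_cell_contracted[OF assms] .
  have "side e u = side e v" if "e \<noteq> ?e" for e using side_eq[OF assms(1)] that by blast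
  then have "(\<Prod>e\<in>Ecs - {?e}. if side e u then 1 else -1) =
      (\<Prod>e\<in>Ecs - {?e}. if side e v then 1 else (-1::real))"
    by (intro prod.cong) auto
  then show ?thesis
    unfolding switching_def prod.remove[OF finite_Ecs e] using side_neq[OF e] by auto
qed

text \<open>The quotient map is a bijection from the edges between different cells to the edges of the quotient:
  it is injective because no two of them are parallel.\<close>

lemma sum_cross_edges:
  fixes F :: "nat \<Rightarrow> nat \<Rightarrow> real"
  shows "(\<Sum>(u,v) | adj G u v \<and> cell u \<noteq> cell v. F (cell u) (cell v)) = (\<Sum>(i,j) | adj quotient i j. F i j)"
proof -
  let ?C = "{(u,v). adj G u v \<and> cell u \<noteq> cell v}"
  have "bij_betw (\<lambda>(u,v). (cell u, cell v)) ?C {(i,j). adj quotient i j}"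
    unfolding bij_betw_def
  proof
    show "inj_on (\<lambda>(u,v). (cell u, cell v)) ?C"
      using cross_edge_unique by (auto simp: inj_on_def)
    show "(\<lambda>(u,v). (cell u, cell v)) ` ?C = {(i,j). adj quotient i j}"
      by (auto simp: adj_quotient_iff image_iff)
  qed
  from sum.reindex_bij_betw[OF this, of "\<lambda>(i,j). F i j"] show ?thesis
    by (simp add: case_prod_unfold)
qed

end

section \<open>Interlacing\<close>

context bridge_contraction
begin

text \<open>The linear map that turns a function \<open>h\<close> on the quotient into \<open>s * (h \<circ> cell)\<close> on \<open>G\<close>, in the coordinates
  in which both functions are scaled by the square roots of the degrees.\<close>

definition pullback_mat :: "('a \<Rightarrow> real) \<Rightarrow> 'a list \<Rightarrow> real mat" where
  "pullback_mat s vs = mat (length vs) (length cells) (\<lambda>(i,j).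
     if cell (vs ! i) = j
     then sqrt (degree_of G (vs ! i)) * s (vs ! i) / sqrt (degree_of quotient j) else 0)"

lemma pullback_mat_carrier: "pullback_mat s vs \<in> carrier_mat (length vs) (length cells)"
  by (simp add: pullback_mat_def)

lemma pullback_mat_apply:
  assumes vs: "set vs = verts G" and x: "x \<in> carrier_vec (length cells)" and i: "i < length vs"
  shows "(pullback_mat s vs *\<^sub>v x) $ i =
    sqrt (degree_of G (vs ! i)) * (s (vs ! i) * (x $ cell (vs ! i) / sqrt (degree_of quotient (cell (vs ! i)))))"
proof -
  have "cell (vs ! i) < length cells" using cell_less vs i nth_mem by blast
  then show ?thesis
    using x i by (simp add: pullback_mat_def scalar_prod_def if_distrib[of "\<lambda>a. a * _"] cong: if_cong)
qed

text \<open>For the Laplacian itself the plain pullback preserves the quadratic form, since it is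
  constant on cells. For \<open>2 - L\<close> the switched pullback does, since it takes opposite values at the two ends of
  each edge inside a cell and equal signs at the ends of all others.\<close>

lemma norm_laplacian_quotient_interlaces:
  assumes G: "connected_graph G" and vs: "distinct vs" "set vs = verts G"
    and p: "2 \<le> length cells" "length cells < length vs"
  shows "interlaces (norm_laplacian quotient [0..<length cells]) (norm_laplacian G vs)"
proof -
  let ?p = "length cells" and ?n = "length vs"
  let ?B = "norm_laplacian quotient [0..<?p]" and ?A = "norm_laplacian G vs"
  let ?S = "pullback_mat (\<lambda>_. 1) vs" and ?T = "pullback_mat switching vs"
  have "2 \<le> card (verts G)" using vs p distinct_card[of vs] by simp
  then have degG: "0 < degree_of G u" if "u \<in> verts G" for u
    using connected_graph_degree_pos[OF simple G] that by blast
  have degH: "0 < degree_of quotient i" if "i \<in> verts quotient" for i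
    using connected_graph_degree_pos[OF simple_quotient connected_quotient[OF G]] that p
    by (simp add: verts_quotient)
  define h where "h x j = x $ j / sqrt (degree_of quotient j)" for x :: "real vec" and j
  have H: "x \<bullet> x = (\<Sum>(i,j) | adj quotient i j. (h x i)\<^sup>2)"
    "(?B *\<^sub>v x) \<bullet> x = (\<Sum>(i,j) | adj quotient i j. (h x i - h x j)\<^sup>2) / 2"
    "2 * (x \<bullet> x) - (?B *\<^sub>v x) \<bullet> x = (\<Sum>(i,j) | adj quotient i j. (h x i + h x j)\<^sup>2) / 2"
    if x: "x \<in> carrier_vec ?p" for x
  proof -
    have xh: "x $ i = sqrt (degree_of quotient ([0..<?p] ! i)) * h x ([0..<?p] ! i)"
      if "i < length [0..<?p]" for i
      using degH[of i] that by (simp add: h_def verts_quotient)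
    have set: "set [0..<?p] = verts quotient" by (auto simp: verts_quotient)
    have x': "x \<in> carrier_vec (length [0..<?p])" using x by simp
    note * = norm_laplacian_quadratic_form[OF simple_quotient distinct_upt set degH x' xh]
    show "x \<bullet> x = (\<Sum>(i,j) | adj quotient i j. (h x i)\<^sup>2)"
      "(?B *\<^sub>v x) \<bullet> x = (\<Sum>(i,j) | adj quotient i j. (h x i - h x j)\<^sup>2) / 2"
      "2 * (x \<bullet> x) - (?B *\<^sub>v x) \<bullet> x = (\<Sum>(i,j) | adj quotient i j. (h x i + h x j)\<^sup>2) / 2"
      using * by blast+
  qed
  have pull: "(pullback_mat s vs *\<^sub>v x) \<bullet> (pullback_mat s vs *\<^sub>v x) =
      (\<Sum>(u,v) | adj G u v. (s u * h x (cell u))\<^sup>2)"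
    "(?A *\<^sub>v (pullback_mat s vs *\<^sub>v x)) \<bullet> (pullback_mat s vs *\<^sub>v x) =
      (\<Sum>(u,v) | adj G u v. (s u * h x (cell u) - s v * h x (cell v))\<^sup>2) / 2"
    "2 * ((pullback_mat s vs *\<^sub>v x) \<bullet> (pullback_mat s vs *\<^sub>v x)) -
      (?A *\<^sub>v (pullback_mat s vs *\<^sub>v x)) \<bullet> (pullback_mat s vs *\<^sub>v x) =
      (\<Sum>(u,v) | adj G u v. (s u * h x (cell u) + s v * h x (cell v))\<^sup>2) / 2"
    if x: "x \<in> carrier_vec ?p" for x s
  proof -
    have c: "pullback_mat s vs *\<^sub>v x \<in> carrier_vec ?n"
      by (rule mult_mat_vec_carrier[OF pullback_mat_carrier x])
    show "(pullback_mat s vs *\<^sub>v x) \<bullet> (pullback_mat s vs *\<^sub>v x) =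
      (\<Sum>(u,v) | adj G u v. (s u * h x (cell u))\<^sup>2)"
    "(?A *\<^sub>v (pullback_mat s vs *\<^sub>v x)) \<bullet> (pullback_mat s vs *\<^sub>v x) =
      (\<Sum>(u,v) | adj G u v. (s u * h x (cell u) - s v * h x (cell v))\<^sup>2) / 2"
    "2 * ((pullback_mat s vs *\<^sub>v x) \<bullet> (pullback_mat s vs *\<^sub>v x)) -
      (?A *\<^sub>v (pullback_mat s vs *\<^sub>v x)) \<bullet> (pullback_mat s vs *\<^sub>v x) =
      (\<Sum>(u,v) | adj G u v. (s u * h x (cell u) + s v * h x (cell v))\<^sup>2) / 2"
      using norm_laplacian_quadratic_form[OF simple vs degG c, where g = "\<lambda>u. s u * h x (cell u)"]
        pullback_mat_apply[OF vs(2) x] unfolding h_def by blast+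
  qed
  have split: "(\<Sum>(u,v) | adj G u v. F u v) = (\<Sum>(u,v) | adj G u v \<and> cell u \<noteq> cell v. F u v) +
      (\<Sum>(u,v) | adj G u v \<and> cell u = cell v. F u v)" for F :: "'a \<Rightarrow> 'a \<Rightarrow> real"
  proof -
    have "{(u,v). adj G u v} = {(u,v). adj G u v \<and> cell u \<noteq> cell v} \<union> {(u,v). adj G u v \<and> cell u = cell v}"
      by auto
    then show ?thesis
      using finite_adj[OF simple] by (simp only:) (subst sum.union_disjoint, auto)
  qed
  \<comment> \<open>The degree of a cell counts only the edges that leave it, hence is at most the sum of the degrees of its vertices.\<close>
  have expand: "x \<bullet> x \<le> (pullback_mat s vs *\<^sub>v x) \<bullet> (pullback_mat s vs *\<^sub>v x)"
    if x: "x \<in> carrier_vec ?p" and s: "\<And>u. (s u)\<^sup>2 = 1" for x s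
  proof -
    have "x \<bullet> x = (\<Sum>(u,v) | adj G u v \<and> cell u \<noteq> cell v. (h x (cell u))\<^sup>2)"
      unfolding H(1)[OF x] by (rule sum_cross_edges[symmetric])
    also have "\<dots> \<le> (\<Sum>(u,v) | adj G u v. (h x (cell u))\<^sup>2)"
      using finite_adj[OF simple] by (intro sum_mono2) auto
    also have "\<dots> = (\<Sum>(u,v) | adj G u v. (s u * h x (cell u))\<^sup>2)"
      by (simp add: power_mult_distrib s)
    finally show ?thesis unfolding pull(1)[OF x] .
  qed
  have lower: "(?A *\<^sub>v (?S *\<^sub>v x)) \<bullet> (?S *\<^sub>v x) = (?B *\<^sub>v x) \<bullet> x" if x: "x \<in> carrier_vec ?p" for x
  proof -
    have "(\<Sum>(u,v) | adj G u v \<and> cell u = cell v. (h x (cell u) - h x (cell v))\<^sup>2) = 0"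
      by (intro sum.neutral) auto
    then show ?thesis
      unfolding pull(2)[OF x] H(2)[OF x] split
      using sum_cross_edges[of "\<lambda>i j. (h x i - h x j)\<^sup>2"] by simp
  qed
  have upper: "2 * ((?T *\<^sub>v x) \<bullet> (?T *\<^sub>v x)) - (?A *\<^sub>v (?T *\<^sub>v x)) \<bullet> (?T *\<^sub>v x) =
      2 * (x \<bullet> x) - (?B *\<^sub>v x) \<bullet> x" if x: "x \<in> carrier_vec ?p" for x
  proof -
    let ?F = "\<lambda>u v. (switching u * h x (cell u) + switching v * h x (cell v))\<^sup>2"
    have "(\<Sum>(u,v) | adj G u v \<and> cell u = cell v. ?F u v) = 0"
      using switching_flip by (intro sum.neutral) auto
    moreover have "?F u v = (h x (cell u) + h x (cell v))\<^sup>2" if "adj G u v" "cell u \<noteq> cell v" for u v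
    proof -
      have "?F u v = (switching v)\<^sup>2 * (h x (cell u) + h x (cell v))\<^sup>2"
        unfolding switching_same[OF that] by (simp add: power2_eq_square algebra_simps)
      then show ?thesis by (simp add: switching_square)
    qed
    then have "(\<Sum>(u,v) | adj G u v \<and> cell u \<noteq> cell v. ?F u v) =
        (\<Sum>(u,v) | adj G u v \<and> cell u \<noteq> cell v. (h x (cell u) + h x (cell v))\<^sup>2)"
      by (intro sum.cong) auto
    ultimately show ?thesis
      unfolding pull(3)[OF x] H(3)[OF x] split
      using sum_cross_edges[of "\<lambda>i j. (h x i + h x j)\<^sup>2"] by simp
  qed
  show ?thesis
  proof (rule interlacesI_form_pullbacks[where S = ?S and T = ?T and c = 2])
    show "real_symmetric ?n ?A" by (rule real_symmetric_norm_laplacian)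
    show "real_symmetric ?p ?B" using real_symmetric_norm_laplacian[of "[0..<?p]"] by simp
  next
    fix x :: "real vec" assume x: "x \<in> carrier_vec ?p"
    show "(?A *\<^sub>v (?S *\<^sub>v x)) \<bullet> (?S *\<^sub>v x) \<le> (?B *\<^sub>v x) \<bullet> x" using lower[OF x] by simp
    show "0 \<le> (?B *\<^sub>v x) \<bullet> x" unfolding H(2)[OF x] by (auto intro!: sum_nonneg)
    show "x \<bullet> x \<le> (?S *\<^sub>v x) \<bullet> (?S *\<^sub>v x)" by (rule expand[OF x]) simp
    show "2 * ((?T *\<^sub>v x) \<bullet> (?T *\<^sub>v x)) - (?A *\<^sub>v (?T *\<^sub>v x)) \<bullet> (?T *\<^sub>v x) \<le> 2 * (x \<bullet> x) - (?B *\<^sub>v x) \<bullet> x"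
      using upper[OF x] by simp
    have "0 \<le> 2 * (x \<bullet> x) - (?B *\<^sub>v x) \<bullet> x" unfolding H(3)[OF x] by (auto intro!: sum_nonneg)
    then show "(?B *\<^sub>v x) \<bullet> x \<le> 2 * (x \<bullet> x)" by simp
    show "x \<bullet> x \<le> (?T *\<^sub>v x) \<bullet> (?T *\<^sub>v x)" by (rule expand[OF x switching_square])
  qed (use p in \<open>auto simp: pullback_mat_carrier\<close>)
qed

end

text \<open>A single vertex has degree \<open>0\<close>, where scaling by degrees breaks down, but its Laplacian is the matrix
  \<open>(1)\<close>. All diagonal entries of a normalized Laplacian are \<open>1\<close>, so a unit vector has the same
  Rayleigh quotient.\<close>

lemma norm_laplacian_single_vertex_interlaces:
  assumes "1 < length vs"
  shows "interlaces (norm_laplacian K [k]) (norm_laplacian L vs)"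
proof -
  let ?A = "norm_laplacian L vs" and ?B = "norm_laplacian K [k]" and ?n = "length vs"
  let ?T = "mat ?n 1 (\<lambda>(i,j). if i = 0 then 1 else 0) :: real mat"
  note A = norm_laplacian_carrier[of L vs]
  have Tx: "?T *\<^sub>v x = (x $ 0) \<cdot>\<^sub>v unit_vec ?n 0" if "x \<in> carrier_vec 1" for x :: "real vec"
    using that assms by (intro eq_vecI) (auto simp: scalar_prod_def unit_vec_def)
  have normT: "(?T *\<^sub>v x) \<bullet> (?T *\<^sub>v x) = x \<bullet> x" if "x \<in> carrier_vec 1" for x
  proof -
    have n: "0 < ?n" using assms by linarith
    have "unit_vec ?n 0 \<bullet> unit_vec ?n 0 = (1::real)"
      using scalar_prod_left_unit[OF unit_vec_carrier n, of 0] n by simp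
    moreover have "x \<bullet> x = x $ 0 * x $ 0" using that by (simp add: scalar_prod_def)
    ultimately show ?thesis unfolding Tx[OF that] by simp
  qed
  have formB: "(?B *\<^sub>v x) \<bullet> x = x \<bullet> x" if "x \<in> carrier_vec 1" for x
    using that by (simp add: scalar_prod_def norm_laplacian_def)
  have formA: "(?A *\<^sub>v (?T *\<^sub>v x)) \<bullet> (?T *\<^sub>v x) = x \<bullet> x" if "x \<in> carrier_vec 1" for x
  proof -
    have A0: "0 < dim_row ?A" "0 < dim_col ?A" "0 < ?n" using A assms by auto
    have "(?A *\<^sub>v unit_vec ?n 0) \<bullet> unit_vec ?n 0 = ?A $$ (0, 0)" using A A0 by simp
    also have "\<dots> = 1" using A0 by (simp add: norm_laplacian_def)
    finally have "(?A *\<^sub>v unit_vec ?n 0) \<bullet> unit_vec ?n 0 = 1" .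
    moreover have "x \<bullet> x = x $ 0 * x $ 0" using that by (simp add: scalar_prod_def)
    moreover have "?A *\<^sub>v (x $ 0 \<cdot>\<^sub>v unit_vec ?n 0) = x $ 0 \<cdot>\<^sub>v (?A *\<^sub>v unit_vec ?n 0)"
      by (rule mult_mat_vec[OF A]) simp
    moreover have "?A *\<^sub>v unit_vec ?n 0 \<in> carrier_vec ?n" using A by simp
    ultimately show ?thesis unfolding Tx[OF that] by simp
  qed
  show ?thesis
  proof (rule interlacesI_form_pullbacks[where S = ?T and T = ?T and c = 2])
    show "real_symmetric ?n ?A" by (rule real_symmetric_norm_laplacian)
    show "real_symmetric 1 ?B" using real_symmetric_norm_laplacian[of "[k]" K] by simp
  next
    fix x :: "real vec" assume x: "x \<in> carrier_vec 1"
    have "0 \<le> x \<bullet> x" by (simp add: scalar_prod_def sum_nonneg)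
    then have "0 \<le> x \<bullet> x" "x \<bullet> x \<le> 2 * (x \<bullet> x)" by simp_all
    then show "0 \<le> (?B *\<^sub>v x) \<bullet> x" "(?B *\<^sub>v x) \<bullet> x \<le> 2 * (x \<bullet> x)"
      by (simp_all only: formB[OF x])
    show "(?A *\<^sub>v (?T *\<^sub>v x)) \<bullet> (?T *\<^sub>v x) \<le> (?B *\<^sub>v x) \<bullet> x"
      unfolding formA[OF x] formB[OF x] ..
    show "2 * ((?T *\<^sub>v x) \<bullet> (?T *\<^sub>v x)) - (?A *\<^sub>v (?T *\<^sub>v x)) \<bullet> (?T *\<^sub>v x) \<le> 2 * (x \<bullet> x) - (?B *\<^sub>v x) \<bullet> x"
      unfolding formA[OF x] formB[OF x] normT[OF x] ..
    show "x \<bullet> x \<le> (?T *\<^sub>v x) \<bullet> (?T *\<^sub>v x)" "x \<bullet> x \<le> (?T *\<^sub>v x) \<bullet> (?T *\<^sub>v x)"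
      unfolding normT[OF x] by simp_all
  qed (use assms in auto)
qed

text \<open>The endpoints of a contracted edge lie in one cell, so one of them can be dropped without
  losing a cell.\<close>

lemma (in edge_contraction) length_cells_less:
  assumes "Ecs \<noteq> {}"
  shows "length cells < card (verts G)"
proof -
  obtain e where e: "e \<in> Ecs" using assms by blast
  then have "e \<in> edges G" using Ecs_edges by blast
  then obtain a b where "e = {a, b}" using simple unfolding simple_graph_def by blast
  with e have ab: "contracted_adj a b" by simp
  have abG: "a \<in> verts G" "b \<in> verts G" "a \<noteq> b" "cell a = cell b"
    using adjD[OF contracted_adj_adj[OF ab]] contracted_adj_same_cell[OF ab] by auto
  have fin: "finite (verts G)" using simple by (simp add: simple_graph_def)
  have "{..<length cells} \<subseteq> cell ` (verts G - {b})"
  proof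
    fix i assume "i \<in> {..<length cells}"
    then obtain u where "u \<in> verts G" "cell u = i" using cell_surj by blast
    then have "i = cell (if u = b then a else u)" "(if u = b then a else u) \<in> verts G - {b}"
      using abG by auto
    then show "i \<in> cell ` (verts G - {b})" by (rule image_eqI)
  qed
  then have "length cells \<le> card (verts G - {b})"
    using fin surj_card_le[of "verts G - {b}" "{..<length cells}"] by simp
  also have "\<dots> < card (verts G)" using fin abG(2) by (rule card_Diff1_less)
  finally show ?thesis .
qed

theorem theorem6:
  fixes G :: "'a graph" and n r :: nat and Ecs :: "'a set set"
    and vs :: "'a list" and cells :: "'a set list"
  assumes "simple_graph G" and "connected_graph G" and "card (verts G) = n"
    and "1 \<le> r" and "r < n"
    and "Ecs \<subseteq> edges G" and "card Ecs = n - r"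
    and "distinct vs" and "set vs = verts G"
    and "distinct cells" and "set cells = contraction_partition G Ecs"
    and "cycle_invariant G cells"
  shows "interlaces (norm_laplacian (contraction G cells) [0..<length cells])
                    (norm_laplacian G vs)"
proof -
  interpret edge_contraction G Ecs cells
    using assms by unfold_locales
  interpret bridge_contraction G Ecs cells
    using cycle_invariant_contracted_bridge[OF assms(12)] by unfold_locales
  have len: "length vs = n" using assms distinct_card by metis
  have "Ecs \<noteq> {}" using assms by auto
  then have less: "length cells < length vs" using length_cells_less assms(3) len by simp
  have "verts G \<noteq> {}" using assms by auto
  then have "0 < length cells" using cell_less by fastforce
  then consider "length cells = 1" | "2 \<le> length cells" by linarith
  then show ?thesis
  proof cases
    case 1
    then show ?thesis using norm_laplacian_single_vertex_interlaces[of vs quotient 0 G] less by simp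
  next
    case 2
    then show ?thesis using norm_laplacian_quotient_interlaces assms less by blast
  qed
qed

end
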